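(* Let $(\mathcal V,d,\mu)$ be the weighted homogeneous tree, with the spaces $H^1(\mu)=H^{1,\infty}(\mu)$, $H^{1,2}(\mu)$, $H^{1,\infty}_{\mathrm{fin}}(\mu)$ and $BMO_1(\mu)$ defined in the context. The following hold: (i) There exists a constant $A>0$ such that for every $f\in BMO_1(\mu)$ there exists a bounded linear functional $L_f$ on $H^1(\mu)$ such that $$L_f(g)=\int_{\mathcal V} f\,g\,\mathrm d\mu\qquad \forall g\in H^{1,\infty}_{\mathrm{fin}}(\mu),$$ and $\|L_f\|_{(H^1)^*}\le A\,\|f\|_{BMO_1}$. (ii) For every bounded linear functional $L$ on $H^1(\mu)$ there exists a unique $f\in BMO_1(\mu)$ such that $L=L_f$, and $\|f\|_{BMO_1}\le C_2\,\|L\|_{(H^1)^*}$, where $C_2$ is a constant such that $\|g\|_{H^{1,\infty}}\le C_2\|g\|_{H^{1,2}}$ for all $g\in H^{1,2}(\mu)=H^{1,\infty}(\mu)$.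
   Context: Tree. Let $m\ge 2$ be an integer and let $T=(\mathcal V,\mathcal E)$ be the infinite homogeneous tree of order $m+1$: a connected acyclic graph in which every vertex has exactly $m+1$ neighbours. Let $d(x,y)$ be the length of the shortest path between $x$ and $y$. Fix a doubly-infinite geodesic $g_0\subset\mathcal V$ (a connected subset such that each of its vertices has exactly two neighbours in it and the shortest path between any two of its vertices lies in it) and a map $N:g_0\to\mathbb Z$ with $|N(x)-N(y)|=d(x,y)$ for all $x,y\in g_0$. The level function is $\ell(x)=N(x')-d(x,x')$, where $x'$ is the vertex of $g_0$ closest to $x$. We say that $x$ lies below $y$ (and $y$ lies above $x$) if $\ell(x)=\ell(y)-d(x,y)$. The measure $\mu$ is defined by $\int_{\mathcal V} f\,\mathrm d\mu=\sum_{x\in\mathcal V}f(x)m^{\ell(x)}$. Functions are complex-valued and $L^p$ norms are taken with respect to $\mu$. Calderón–Zygmund sets. A (nonempty) set $\tilde R\subset \mathcal V$ is a Calderón–Zygmund set if either it is a single vertex (degenerate case) or there are $x_R\in\mathcal V$ and an integer $h\ge 1$ such that $\tilde R=\{x: x\text{ lies below }x_R,\ h/2\le \ell(x_R)-\ell(x)<4h\}$. Let $\mathcal R$ be the family of all Calderón–Zygmund sets. Hardy spaces. For $p\in(1,\infty]$, a $(1,p)$-atom is a function $a$ supported in some $\tilde R\in\mathcal R$ with $\|a\|_{L^p}\le\mu(\tilde R)^{1/p-1}$ and $\int_{\mathcal V} a\,\mathrm d\mu=0$. $H^{1,p}(\mu)$ is the space of $g\in L^1(\mu)$ of the form $g=\sum_{j\in\mathbb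 N}\lambda_ja_j$ with $a_j$ $(1,p)$-atoms and $\lambda_j\in\mathbb C$, $\sum_j|\lambda_j|<\infty$; $\|g\|_{H^{1,p}}$ is the infimum of $\sum_j|\lambda_j|$ over all such decompositions. $H^{1,p}_{\mathrm{fin}}(\mu)$ is the space of finite linear combinations of $(1,p)$-atoms. For all $p\in(1,\infty)$ it is known that $H^{1,p}(\mu)=H^{1,\infty}(\mu)$ and that there is a constant $C_p$ with $\|g\|_{H^{1,p}}\le\|g\|_{H^{1,\infty}}\le C_p\|g\|_{H^{1,p}}$. We write $H^1(\mu)=H^{1,\infty}(\mu)$ with $\|\cdot\|_{H^1}=\|\cdot\|_{H^{1,\infty}}$. BMO. For $f:\mathcal V\to\mathbb C$ and $\tilde R\in\mathcal R$ let $f_{\tilde R}=\mu(\tilde R)^{-1}\int_{\tilde R}f\,\mathrm d\mu$. $BMO_1(\mu)$ is the quotient by constant functions of the space of functions $f$ with $\|f\|_{BMO_1}=\sup_{\tilde R\in\mathcal R}\frac1{\mu(\tilde R)}\int_{\tilde R}|f-f_{\tilde R}|\,\mathrm d\mu<\infty$. Since functions in $H^{1,\infty}_{\mathrm{fin}}(\mu)$ have vanishing integral, $\int fg\,\mathrm d\mu$ does not depend on the representative $f$. *)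

theory Defs
  imports "HOL-Analysis.Analysis" "HOL-Probability.Essential_Supremum"
begin

text \<open>The vertex set is the whole type \<open>'v\<close>; \<open>E\<close> is the adjacency relation.\<close>

definition vertex_path :: "('v \<Rightarrow> 'v \<Rightarrow> bool) \<Rightarrow> 'v \<Rightarrow> 'v \<Rightarrow> 'v list \<Rightarrow> bool" where
  "vertex_path E x y xs \<longleftrightarrow>
     xs \<noteq> [] \<and> hd xs = x \<and> last xs = y \<and> successively E xs \<and> distinct xs"

definition graph_dist :: "('v \<Rightarrow> 'v \<Rightarrow> bool) \<Rightarrow> 'v \<Rightarrow> 'v \<Rightarrow> nat" where
  "graph_dist E x y = (LEAST n. \<exists>xs. vertex_path E x y xs \<and> length xs = Suc n)"

text \<open>A cycle is given by its at least three distinct vertices in cyclic order. Infinity of the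
  tree follows from the degree condition.\<close>

definition homogeneous_tree :: "nat \<Rightarrow> ('v \<Rightarrow> 'v \<Rightarrow> bool) \<Rightarrow> bool" where
  "homogeneous_tree m E \<longleftrightarrow>
     (\<forall>x. \<not> E x x) \<and> (\<forall>x y. E x y \<longrightarrow> E y x) \<and>
     (\<forall>x y. \<exists>xs. vertex_path E x y xs) \<and>
     \<not> (\<exists>xs. 3 \<le> length xs \<and> distinct xs \<and> successively E xs \<and> E (last xs) (hd xs)) \<and>
     (\<forall>x. card {y. E x y} = m + 1)"

definition infinite_geodesic :: "('v \<Rightarrow> 'v \<Rightarrow> bool) \<Rightarrow> 'v set \<Rightarrow> bool" where
  "infinite_geodesic E g0 \<longleftrightarrow>
     g0 \<noteq> {} \<and>
     (\<forall>x\<in>g0. \<forall>y\<in>g0. \<exists>xs. vertex_path E x y xs \<and> set xs \<subseteq> g0) \<and>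
     (\<forall>x\<in>g0. card {y\<in>g0. E x y} = 2) \<and>
     (\<forall>x\<in>g0. \<forall>y\<in>g0. \<forall>xs. vertex_path E x y xs \<and> length xs = Suc (graph_dist E x y)
        \<longrightarrow> set xs \<subseteq> g0)"

definition level :: "('v \<Rightarrow> 'v \<Rightarrow> bool) \<Rightarrow> 'v set \<Rightarrow> ('v \<Rightarrow> int) \<Rightarrow> 'v \<Rightarrow> int" where
  "level E g0 N x =
     (let x' = (ARG_MIN (graph_dist E x) y. y \<in> g0) in N x' - int (graph_dist E x x'))"

definition lies_below ::
  "('v \<Rightarrow> 'v \<Rightarrow> bool) \<Rightarrow> 'v set \<Rightarrow> ('v \<Rightarrow> int) \<Rightarrow> 'v \<Rightarrow> 'v \<Rightarrow> bool" where
  "lies_below E g0 N x y \<longleftrightarrow> level E g0 N x = level E g0 N y - int (graph_dist E x y)"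

definition tree_measure ::
  "nat \<Rightarrow> ('v \<Rightarrow> 'v \<Rightarrow> bool) \<Rightarrow> 'v set \<Rightarrow> ('v \<Rightarrow> int) \<Rightarrow> 'v measure" where
  "tree_measure m E g0 N = point_measure UNIV (\<lambda>x. ennreal (real m powi level E g0 N x))"

definition CZ_sets :: "('v \<Rightarrow> 'v \<Rightarrow> bool) \<Rightarrow> 'v set \<Rightarrow> ('v \<Rightarrow> int) \<Rightarrow> 'v set set" where
  "CZ_sets E g0 N = {R. R \<noteq> {} \<and>
     ((\<exists>x. R = {x}) \<or>
      (\<exists>xR (h::int). 1 \<le> h \<and>
        R = {x. lies_below E g0 N x xR \<and>
                real_of_int h / 2 \<le> real_of_int (level E g0 N xR - level E g0 N x) \<and>
                level E g0 N xR - level E g0 N x < 4 * h}))}"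

text \<open>Below, \<open>M\<close> is a measure and \<open>\<R>\<close> a family of sets playing the role of the
  Calderon-Zygmund sets. In the tree all these sets are finite, and every vertex has positive
  finite mass, so functions need not be identified modulo null sets.\<close>

definition Lp_norm :: "'v measure \<Rightarrow> ereal \<Rightarrow> ('v \<Rightarrow> complex) \<Rightarrow> ereal" where
  "Lp_norm M p f =
     (if p = \<infinity> then esssup M (\<lambda>x. ereal (cmod (f x)))
      else if integrable M (\<lambda>x. cmod (f x) powr real_of_ereal p)
      then ereal ((\<integral>x. cmod (f x) powr real_of_ereal p \<partial>M) powr (1 / real_of_ereal p))
      else \<infinity>)"

text \<open>The exponent is meant to satisfy \<open>1 < p \<le> \<infinity>\<close>; note that \<open>1 / \<infinity> = 0\<close> in \<^typ>\<open>ereal\<close>.\<close>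

definition atoms :: "'v measure \<Rightarrow> 'v set set \<Rightarrow> ereal \<Rightarrow> ('v \<Rightarrow> complex) set" where
  "atoms M \<R> p = {a. \<exists>R\<in>\<R>.
     (\<forall>x. x \<notin> R \<longrightarrow> a x = 0) \<and>
     Lp_norm M p a \<le> ereal (measure M R powr (real_of_ereal (1 / p) - 1)) \<and>
     has_bochner_integral M a 0}"

text \<open>The series is understood to converge in \<open>L\<^sup>1\<close>.\<close>

definition atomic_decomposition ::
  "'v measure \<Rightarrow> 'v set set \<Rightarrow> ereal \<Rightarrow> ('v \<Rightarrow> complex) \<Rightarrow>
   (nat \<Rightarrow> complex) \<Rightarrow> (nat \<Rightarrow> 'v \<Rightarrow> complex) \<Rightarrow> bool" where
  "atomic_decomposition M \<R> p g c a \<longleftrightarrow>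
     integrable M g \<and> (\<forall>j. a j \<in> atoms M \<R> p) \<and> summable (\<lambda>j. cmod (c j)) \<and>
     (\<lambda>n. \<integral>x. cmod (g x - (\<Sum>j<n. c j * a j x)) \<partial>M) \<longlonglongrightarrow> 0"

definition hardy :: "'v measure \<Rightarrow> 'v set set \<Rightarrow> ereal \<Rightarrow> ('v \<Rightarrow> complex) set" where
  "hardy M \<R> p = {g. \<exists>c a. atomic_decomposition M \<R> p g c a}"

definition hardy_norm ::
  "'v measure \<Rightarrow> 'v set set \<Rightarrow> ereal \<Rightarrow> ('v \<Rightarrow> complex) \<Rightarrow> real" where
  "hardy_norm M \<R> p g = Inf {\<Sum>j. cmod (c j) | c a. atomic_decomposition M \<R> p g c a}"

definition hardy_fin :: "'v measure \<Rightarrow> 'v set set \<Rightarrow> ereal \<Rightarrow> ('v \<Rightarrow> complex) set" where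
  "hardy_fin M \<R> p = {\<lambda>x. \<Sum>j<n. c j * a j x | n (c :: nat \<Rightarrow> complex) a.
     \<forall>j<n. a j \<in> atoms M \<R> p}"

text \<open>Functionals on \<open>H\<^sup>1 = H\<^sup>1\<^sup>,\<^sup>\<infinity>\<close> are total functions in HOL whose values outside
  \<open>H\<^sup>1\<close> are irrelevant.\<close>

definition bounded_functional ::
  "'v measure \<Rightarrow> 'v set set \<Rightarrow> (('v \<Rightarrow> complex) \<Rightarrow> complex) \<Rightarrow> bool" where
  "bounded_functional M \<R> L \<longleftrightarrow>
     (\<forall>g\<in>hardy M \<R> \<infinity>. \<forall>h\<in>hardy M \<R> \<infinity>. L (\<lambda>x. g x + h x) = L g + L h) \<and>
     (\<forall>g\<in>hardy M \<R> \<infinity>. \<forall>c. L (\<lambda>x. c * g x) = c * L g) \<and>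
     (\<exists>K. \<forall>g\<in>hardy M \<R> \<infinity>. cmod (L g) \<le> K * hardy_norm M \<R> \<infinity> g)"

definition dual_norm ::
  "'v measure \<Rightarrow> 'v set set \<Rightarrow> (('v \<Rightarrow> complex) \<Rightarrow> complex) \<Rightarrow> real" where
  "dual_norm M \<R> L = (SUP g\<in>{g\<in>hardy M \<R> \<infinity>. hardy_norm M \<R> \<infinity> g \<le> 1}. cmod (L g))"

definition average :: "'v measure \<Rightarrow> ('v \<Rightarrow> complex) \<Rightarrow> 'v set \<Rightarrow> complex" where
  "average M f R = (LINT x:R|M. f x) / complex_of_real (measure M R)"

definition mean_oscillation :: "'v measure \<Rightarrow> ('v \<Rightarrow> complex) \<Rightarrow> 'v set \<Rightarrow> real" where
  "mean_oscillation M f R = (LINT x:R|M. cmod (f x - average M f R)) / measure M R"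

definition BMO_functions :: "'v measure \<Rightarrow> 'v set set \<Rightarrow> ('v \<Rightarrow> complex) set" where
  "BMO_functions M \<R> = {f. bdd_above (mean_oscillation M f ` \<R>)}"

definition BMO_seminorm :: "'v measure \<Rightarrow> 'v set set \<Rightarrow> ('v \<Rightarrow> complex) \<Rightarrow> real" where
  "BMO_seminorm M \<R> f = (SUP R\<in>\<R>. mean_oscillation M f R)"

definition BMO :: "'v measure \<Rightarrow> 'v set set \<Rightarrow> ('v \<Rightarrow> complex) set set" where
  "BMO M \<R> = BMO_functions M \<R> //
     {(f, f'). f \<in> BMO_functions M \<R> \<and> f' \<in> BMO_functions M \<R> \<and> (\<exists>c. \<forall>x. f' x = f x + c)}"

text \<open>The seminorm is constant on each class of functions modulo constants, so its image of a
  class is a singleton.\<close>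

definition BMO_norm :: "'v measure \<Rightarrow> 'v set set \<Rightarrow> ('v \<Rightarrow> complex) set \<Rightarrow> real" where
  "BMO_norm M \<R> F = the_elem (BMO_seminorm M \<R> ` F)"

end

theory Submission
  imports Defs
begin

text \<open>The duality is proved for a measure on a discrete space in which every point has positive
  finite mass, and a family of finite sets such that any two points lie in a common member. Atoms
  then have finite support, so they can be integrated against every function.

  A BMO function \<open>f\<close> pairs with an atom to a number of modulus at most its seminorm, so the value
  \<open>\<Sum>j. c j * \<integral>f a j\<close> is bounded by the seminorm times \<open>\<Sum>j. \<bar>c j\<bar>\<close>. The difficulty is that this
  value must not depend on the atomic decomposition of \<open>g\<close>, although \<open>f g\<close> need not be integrable.
  Truncating \<open>f\<close> by the retraction of the plane onto a disc resolves it: the retraction is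
  1-Lipschitz, so truncation does not increase the bound on the pairing with an atom, whereas
  for a bounded function the value is the integral against \<open>g\<close> (\<open>bounded_pairing_sums\<close>).
  Tannery's theorem removes the truncation (\<open>truncated_pairing_tendsto\<close>). Hence part (i) holds
  with constant 1.

  Conversely, a functional \<open>L\<close> is determined on finitely supported functions of mean zero by its
  values on differences of two normalised point masses, and these values are the differences
  \<open>f x - f y\<close> of a function \<open>f\<close>, unique up to a constant
  (\<open>bounded_functional_represented_on_atoms\<close>). The mean oscillation of \<open>f\<close> over a set is the
  value of \<open>L\<close> at a single test function which is a \<open>(1,2)\<close>-atom
  (\<open>mean_oscillation_tested_by_atom\<close>). This bounds the seminorm by \<open>C\<^sub>2\<close> times the norm of \<open>L\<close>.

  For the tree it remains to see that Calderon-Zygmund sets are finite and that two vertices lie in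
  a common one (\<open>CZ_set_containing_two_points\<close>): far up on the geodesic there are vertices
  above both, at comparable heights. Acyclicity enters here: it makes the shortest path from a
  vertex to any point of the geodesic run through the projection of the vertex.\<close>

section \<open>Paths and distances in the tree\<close>

lemma vertex_path_Cons:
  "vertex_path E x y (z # xs) \<longleftrightarrow> z = x \<and>
     (if xs = [] then x = y else E x (hd xs) \<and> vertex_path E (hd xs) y xs \<and> x \<notin> set xs)"
  by (cases xs) (auto simp: vertex_path_def)

lemma successively_rev_sym:
  assumes "\<And>x y. E x y \<Longrightarrow> E y x" "successively E xs"
  shows "successively E (rev xs)"
  using assms by (auto intro: successively_mono)

text \<open>If two paths to \<open>y\<close> leave \<open>x\<close> through different neighbours, follow the first one up to the
  first vertex \<open>v\<close> that it shares with the second one and return along the second one: this is a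
  cycle through \<open>x\<close>. Hence the paths agree step by step.\<close>

lemma vertex_path_unique:
  assumes sym: "\<And>x y. E x y \<Longrightarrow> E y x"
    and acyclic: "\<nexists>xs. 3 \<le> length xs \<and> distinct xs \<and> successively E xs \<and> E (last xs) (hd xs)"
    and "vertex_path E x y p" "vertex_path E x y q"
  shows "p = q"
  using assms(3,4)
proof (induction p arbitrary: x q)
  case Nil
  then show ?case by (simp add: vertex_path_def)
next
  case (Cons z p)
  then have z: "z = x" by (simp add: vertex_path_def)
  obtain q' where q: "q = x # q'"
    using Cons.prems(2) by (cases q) (auto simp: vertex_path_def)
  show ?case
  proof (cases "p = [] \<or> q' = []")
    case True
    then show ?thesis
      using Cons.prems by (cases p; cases q') (auto simp: vertex_path_def z q split: if_splits)
  next
    case False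
    have p: "E x (hd p)" "vertex_path E (hd p) y p" "x \<notin> set p"
      using Cons.prems(1) False by (auto simp: vertex_path_Cons z)
    have q': "E x (hd q')" "vertex_path E (hd q') y q'" "x \<notin> set q'"
      using Cons.prems(2) False by (auto simp: vertex_path_Cons q)
    have "hd p = hd q'"
    proof (rule ccontr)
      assume ne: "hd p \<noteq> hd q'"
      have "y \<in> set p" "y \<in> set q'"
        using p(2) q'(2) last_in_set[of p] last_in_set[of q'] by (auto simp: vertex_path_def)
      then obtain A v B where pd: "p = A @ v # B" "v \<in> set q'" "\<forall>a\<in>set A. a \<notin> set q'"
        using split_list_first_prop[of p "\<lambda>a. a \<in> set q'"] by blast
      obtain C D where qd: "q' = C @ v # D"
        using pd(2) by (meson split_list)
      define c where "c = x # (A @ v # rev C)"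
      have "successively E (A @ [v])"
        using p(2) unfolding vertex_path_def pd by (auto simp: successively_append_iff)
      moreover have "successively E (v # rev C)"
      proof -
        have "successively E (C @ [v])"
          using q'(2) unfolding vertex_path_def qd by (auto simp: successively_append_iff)
        then show ?thesis
          using successively_rev_sym[where xs = "C @ [v]" and E = E] sym by auto
      qed
      moreover have "E x (hd (A @ v # rev C))"
        using p(1) unfolding pd by (cases A) auto
      ultimately have "successively E c"
        unfolding c_def by (auto simp: successively_append_iff successively_Cons)
      moreover have "distinct c"
        using p(2,3) q'(2,3) pd(3) unfolding vertex_path_def pd qd c_def by auto
      moreover have "E (last c) (hd c)"
        using sym[OF q'(1)] unfolding c_def qd by (cases C) auto
      moreover have "3 \<le> length c"
      proof (rule ccontr)
        assume "\<not> 3 \<le> length c"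
        then have "A = []" "C = []" by (auto simp: c_def not_le less_Suc_eq numeral_3_eq_3)
        then show False using ne by (simp add: pd qd)
      qed
      ultimately show False using acyclic by blast
    qed
    then show ?thesis
      using Cons.IH[OF p(2)] q'(2) z q by simp
  qed
qed

lemma graph_dist_attained:
  assumes "\<exists>xs. vertex_path E x y xs"
  shows "\<exists>xs. vertex_path E x y xs \<and> length xs = Suc (graph_dist E x y)"
proof -
  obtain xs where xs: "vertex_path E x y xs" using assms by blast
  then have "\<exists>ys. vertex_path E x y ys \<and> length ys = Suc (length xs - 1)"
    by (intro exI[of _ xs]) (auto simp: vertex_path_def)
  then show ?thesis
    unfolding graph_dist_def by (rule LeastI)
qed

lemma finite_ball:
  assumes sym: "\<And>x y. E x y \<Longrightarrow> E y x"
    and connected: "\<And>x y. \<exists>xs. vertex_path E x y xs"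
    and locally_finite: "\<And>x. finite {y. E x y}"
  shows "finite {x. graph_dist E x y \<le> n}"
proof -
  have step: "\<exists>z. E x z \<and> graph_dist E z y \<le> n" if xy: "graph_dist E x y = Suc n" for x n
  proof -
    obtain xs where xs: "vertex_path E x y xs" "length xs = Suc (Suc n)"
      using graph_dist_attained[OF connected, of x y] xy by auto
    then obtain zs where "xs = x # zs"
      by (cases xs) (auto simp: vertex_path_def)
    then have "E x (hd zs)" "vertex_path E (hd zs) y zs" "length zs = Suc n"
      using xs by (auto simp: vertex_path_Cons split: if_splits)
    then show ?thesis
      unfolding graph_dist_def by (blast intro: Least_le)
  qed
  show ?thesis
  proof (induction n)
    case 0
    have "x = y" if "graph_dist E x y = 0" for x
      using graph_dist_attained[OF connected, of x y] that
      by (auto simp: vertex_path_def length_Suc_conv)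
    then have "{x. graph_dist E x y \<le> 0} \<subseteq> {y}" by auto
    then show ?case by (rule finite_subset) simp
  next
    case (Suc n)
    have "{x. graph_dist E x y \<le> Suc n} \<subseteq>
        {x. graph_dist E x y \<le> n} \<union> (\<Union>z\<in>{z. graph_dist E z y \<le> n}. {x. E z x})"
      using step sym by (fastforce simp: le_Suc_eq)
    then show ?case
      by (rule finite_subset) (use Suc locally_finite in auto)
  qed
qed

lemma homogeneous_treeD:
  assumes "homogeneous_tree m E"
  shows "\<And>x. \<not> E x x" "\<And>x y. E x y \<Longrightarrow> E y x" "\<And>x y. \<exists>xs. vertex_path E x y xs"
    "\<nexists>xs. 3 \<le> length xs \<and> distinct xs \<and> successively E xs \<and> E (last xs) (hd xs)"
    "\<And>x. finite {y. E x y}"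
proof -
  show "\<And>x. \<not> E x x" "\<And>x y. E x y \<Longrightarrow> E y x" "\<And>x y. \<exists>xs. vertex_path E x y xs"
    "\<nexists>xs. 3 \<le> length xs \<and> distinct xs \<and> successively E xs \<and> E (last xs) (hd xs)"
    using assms unfolding homogeneous_tree_def by blast+
  fix x
  have "card {y. E x y} = m + 1" using assms unfolding homogeneous_tree_def by blast
  then show "finite {y. E x y}" by (metis Suc_eq_plus1 card.infinite nat.distinct(1))
qed

lemma path_length_eq_dist:
  assumes "homogeneous_tree m E" "vertex_path E x y xs"
  shows "length xs = Suc (graph_dist E x y)"
  using graph_dist_attained[of E x y] vertex_path_unique[OF homogeneous_treeD(2,4)[OF assms(1)]]
    assms(2) by blast

lemma graph_dist_eq_0_iff:
  assumes "homogeneous_tree m E"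
  shows "graph_dist E x y = 0 \<longleftrightarrow> x = y"
proof
  show "graph_dist E x y = 0 \<Longrightarrow> x = y"
    using graph_dist_attained[OF homogeneous_treeD(3)[OF assms], of x y]
    by (auto simp: vertex_path_def length_Suc_conv)
  have "vertex_path E x x [x]" by (simp add: vertex_path_def)
  then show "x = y \<Longrightarrow> graph_dist E x y = 0"
    using path_length_eq_dist[OF assms] by fastforce
qed

lemma graph_dist_edge:
  assumes "homogeneous_tree m E" "E x y"
  shows "graph_dist E x y = 1"
proof -
  have "vertex_path E x y [x, y]"
    using homogeneous_treeD(1)[OF assms(1)] assms(2) by (auto simp: vertex_path_def)
  then show ?thesis using path_length_eq_dist[OF assms(1)] by fastforce
qed

text \<open>The shortest path from \<open>x\<close> to its closest point \<open>x'\<close> on the geodesic meets the geodesic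
  only in \<open>x'\<close>, so it can be continued along the geodesic without repeating a vertex; in a tree
  this simple path is the shortest one.\<close>

lemma graph_dist_through_closest_point:
  assumes tree: "homogeneous_tree m E" and geo: "infinite_geodesic E g0"
    and x': "x' \<in> g0" "\<And>y. y \<in> g0 \<Longrightarrow> graph_dist E x x' \<le> graph_dist E x y" and z: "z \<in> g0"
  shows "graph_dist E x z = graph_dist E x x' + graph_dist E x' z"
proof -
  obtain p where p: "vertex_path E x x' p" using homogeneous_treeD(3)[OF tree] by blast
  have lp: "length p = Suc (graph_dist E x x')" by (rule path_length_eq_dist[OF tree p])
  obtain q where q: "vertex_path E x' z q" "set q \<subseteq> g0"
    using geo x'(1) z unfolding infinite_geodesic_def by meson
  have lq: "length q = Suc (graph_dist E x' z)" by (rule path_length_eq_dist[OF tree q(1)])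
  have "p \<noteq> []" "last p = x'" using p by (auto simp: vertex_path_def)
  then obtain r where r: "p = r @ [x']" by (metis append_butlast_last_id)
  obtain s where s: "q = x' # s" using q by (cases q) (auto simp: vertex_path_def)
  have disj: "v \<notin> g0" if v: "v \<in> set r" for v
  proof
    assume "v \<in> g0"
    obtain r1 r2 where r12: "r = r1 @ v # r2" using v by (meson split_list)
    have "vertex_path E x v (r1 @ [v])"
      using p unfolding vertex_path_def r r12
      by (auto simp: successively_append_iff hd_append split: if_splits)
    from path_length_eq_dist[OF tree this] have "graph_dist E x v < graph_dist E x x'"
      using lp by (simp add: r r12)
    with x'(2)[OF \<open>v \<in> g0\<close>] show False by simp
  qed
  have "vertex_path E x z (r @ x' # s)"
    using p q disj unfolding vertex_path_def r s
    by (auto simp: successively_append_iff hd_append split: if_splits)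
  from path_length_eq_dist[OF tree this] show ?thesis
    using lp lq by (simp add: r s)
qed

text \<open>The two neighbours of \<open>z\<close> on the geodesic have different labels in
  \<open>{N z - 1, N z + 1}\<close>, so one of them is \<open>N z + 1\<close>.\<close>

lemma labels_unbounded:
  assumes tree: "homogeneous_tree m E" and geo: "infinite_geodesic E g0"
    and lab: "\<And>x y. x \<in> g0 \<Longrightarrow> y \<in> g0 \<Longrightarrow> \<bar>N x - N y\<bar> = int (graph_dist E x y)"
  shows "\<exists>z\<in>g0. b \<le> N z"
proof -
  have up: "\<exists>y\<in>g0. N y = N z + 1" if z: "z \<in> g0" for z
  proof -
    have "card {y \<in> g0. E z y} = 2"
      using geo z unfolding infinite_geodesic_def by blast
    then obtain y1 y2 where "{y \<in> g0. E z y} = {y1, y2}" "y1 \<noteq> y2"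
      by (auto simp: card_2_iff)
    then have y: "y1 \<in> g0" "y2 \<in> g0" "E z y1" "E z y2" "y1 \<noteq> y2" by blast+
    then have "\<bar>N z - N y1\<bar> = 1" "\<bar>N z - N y2\<bar> = 1" "N y1 \<noteq> N y2"
      using lab[OF z y(1)] lab[OF z y(2)] lab[OF y(1,2)] graph_dist_edge[OF tree]
        graph_dist_eq_0_iff[OF tree, of y1 y2] by auto
    then have "N y1 = N z + 1 \<or> N y2 = N z + 1" by linarith
    then show ?thesis using y by blast
  qed
  obtain z0 where z0: "z0 \<in> g0" using geo unfolding infinite_geodesic_def by blast
  have climb: "\<exists>z\<in>g0. N z = N z0 + int n" for n
  proof (induction n)
    case (Suc n)
    then show ?case using up by force
  qed (use z0 in auto)
  from climb[of "nat (b - N z0)"] show ?thesis by force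
qed

lemma closest_point_on_geodesic:
  fixes x :: 'v
  assumes "infinite_geodesic E g0"
  defines "x' \<equiv> (ARG_MIN (graph_dist E x) y. y \<in> g0)"
  shows "x' \<in> g0" "\<And>y. y \<in> g0 \<Longrightarrow> graph_dist E x x' \<le> graph_dist E x y"
proof -
  obtain z where "z \<in> g0" using assms(1) unfolding infinite_geodesic_def by blast
  then show "x' \<in> g0" unfolding x'_def by (rule arg_min_natI)
  show "\<And>y. y \<in> g0 \<Longrightarrow> graph_dist E x x' \<le> graph_dist E x y"
    unfolding x'_def by (rule arg_min_nat_le)
qed

lemma level_on_geodesic:
  assumes tree: "homogeneous_tree m E" and geo: "infinite_geodesic E g0" and z: "z \<in> g0"
  shows "level E g0 N z = N z"
proof -
  let ?z' = "ARG_MIN (graph_dist E z) y. y \<in> g0"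
  have "graph_dist E z ?z' = 0"
    using closest_point_on_geodesic(2)[where x = z, OF geo z] graph_dist_eq_0_iff[OF tree, of z z] by simp
  then show ?thesis
    using graph_dist_eq_0_iff[OF tree, of z ?z'] by (simp add: level_def Let_def)
qed

lemma eventually_lies_below_geodesic:
  assumes tree: "homogeneous_tree m E" and geo: "infinite_geodesic E g0"
    and lab: "\<And>x y. x \<in> g0 \<Longrightarrow> y \<in> g0 \<Longrightarrow> \<bar>N x - N y\<bar> = int (graph_dist E x y)"
  shows "\<exists>b. \<forall>z\<in>g0. b \<le> N z \<longrightarrow> lies_below E g0 N x z"
proof (intro exI ballI impI)
  let ?x' = "ARG_MIN (graph_dist E x) y. y \<in> g0"
  fix z assume z: "z \<in> g0" "N ?x' \<le> N z"
  note x' = closest_point_on_geodesic[where x = x, OF geo]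
  have "graph_dist E x z = graph_dist E x ?x' + graph_dist E ?x' z"
    by (rule graph_dist_through_closest_point[OF tree geo x' z(1)])
  moreover have "int (graph_dist E ?x' z) = N z - N ?x'"
    using lab[OF x'(1) z(1)] z(2) by linarith
  ultimately show "lies_below E g0 N x z"
    unfolding lies_below_def level_on_geodesic[OF tree geo z(1)] by (simp add: level_def Let_def)
qed

section \<open>Calderon-Zygmund sets\<close>

lemma finite_CZ_set:
  assumes tree: "homogeneous_tree m E" and R: "R \<in> CZ_sets E g0 N"
  shows "finite R"
proof -
  from R consider x where "R = {x}" | xR h where "R = {x. lies_below E g0 N x xR \<and>
        real_of_int h / 2 \<le> real_of_int (level E g0 N xR - level E g0 N x) \<and>
        level E g0 N xR - level E g0 N x < 4 * h}"
    unfolding CZ_sets_def by blast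
  then show ?thesis
  proof cases
    case 2
    then have "R \<subseteq> {x. graph_dist E x xR \<le> nat (4 * h)}"
      by (auto simp: lies_below_def)
    then show ?thesis
      using finite_ball[OF homogeneous_treeD(2,3,5)[OF tree]] by (rule finite_subset)
  qed simp
qed

text \<open>Far up on the geodesic there is a vertex \<open>z\<close> above both \<open>x\<close> and \<open>y\<close>, and once it is
  far enough up, the depths of \<open>x\<close> and \<open>y\<close> below \<open>z\<close> differ at most by the factor \<open>2\<close>. With
  \<open>h\<close> the larger depth, both vertices then have depth in \<open>[h/2, 4h)\<close>.\<close>

lemma CZ_set_containing_two_points:
  assumes tree: "homogeneous_tree m E" and geo: "infinite_geodesic E g0"
    and lab: "\<And>x y. x \<in> g0 \<Longrightarrow> y \<in> g0 \<Longrightarrow> \<bar>N x - N y\<bar> = int (graph_dist E x y)"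
  shows "\<exists>R\<in>CZ_sets E g0 N. x \<in> R \<and> y \<in> R"
proof -
  let ?l = "level E g0 N"
  obtain kx where kx: "\<forall>z\<in>g0. kx \<le> N z \<longrightarrow> lies_below E g0 N x z"
    using eventually_lies_below_geodesic[where x = x, OF tree geo lab] by blast
  obtain ky where ky: "\<forall>z\<in>g0. ky \<le> N z \<longrightarrow> lies_below E g0 N y z"
    using eventually_lies_below_geodesic[where x = y, OF tree geo lab] by blast
  define M where "M = max (?l x) (?l y)"
  define M' where "M' = min (?l x) (?l y)"
  obtain z where z: "z \<in> g0" "max (max kx ky) (max (M + 1) (2 * M - M')) \<le> N z"
    using labels_unbounded[where N = N, OF tree geo lab] by blast
  define h where "h = N z - M'"
  define R where "R = {v. lies_below E g0 N v z \<and>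
                real_of_int h / 2 \<le> real_of_int (?l z - ?l v) \<and> ?l z - ?l v < 4 * h}"
  have lz: "?l z = N z" by (rule level_on_geodesic[OF tree geo z(1)])
  have MM: "?l x \<le> M" "?l y \<le> M" "M' \<le> ?l x" "M' \<le> ?l y" by (auto simp: M_def M'_def)
  have h: "1 \<le> h" using z(2) MM unfolding h_def by auto
  have depth: "h \<le> 2 * (N z - ?l x)" "h \<le> 2 * (N z - ?l y)" "N z - ?l x \<le> h" "N z - ?l y \<le> h"
    using z(2) MM unfolding h_def by auto
  have "x \<in> R" "y \<in> R"
    using kx ky z depth h unfolding R_def lz by auto
  moreover have "R \<in> CZ_sets E g0 N"
    unfolding CZ_sets_def using h \<open>x \<in> R\<close> R_def by blast
  ultimately show ?thesis by blast
qed

section \<open>Measures on discrete spaces\<close>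

text \<open>The last assumption makes the difference of any two normalised point masses a multiple of an
  atom. Hence the functions annihilated by all atoms are the constants.\<close>

locale discrete_atomic_space =
  fixes M :: "'v measure" and \<R> :: "'v set set"
  assumes sets_eq_UNIV: "sets M = UNIV"
    and emeasure_singleton: "0 < emeasure M {x}" "emeasure M {x} < top"
    and finite_family: "R \<in> \<R> \<Longrightarrow> finite R"
    and nonempty_family: "R \<in> \<R> \<Longrightarrow> R \<noteq> {}"
    and two_points: "\<exists>R\<in>\<R>. x \<in> R \<and> y \<in> R"
begin

definition weight :: "'v \<Rightarrow> real" where
  "weight x = measure M {x}"

lemma space_eq_UNIV: "space M = UNIV"
  by (metis UNIV_I sets.sets_into_space sets_eq_UNIV top.extremum_uniqueI)

lemma measurable_any: "f \<in> borel_measurable M"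
  by (auto simp: measurable_def space_eq_UNIV sets_eq_UNIV)

lemma weight_pos: "0 < weight x"
  using emeasure_singleton[of x] by (simp add: weight_def measure_def enn2real_positive_iff)

lemma has_integral_finite_support:
  fixes f :: "'v \<Rightarrow> 'b::{banach, second_countable_topology}"
  assumes "finite S" "\<And>x. x \<notin> S \<Longrightarrow> f x = 0"
  shows "has_bochner_integral M f (\<Sum>x\<in>S. weight x *\<^sub>R f x)"
proof -
  have "has_bochner_integral M (\<lambda>y. \<Sum>x\<in>S. indicator {x} y *\<^sub>R f x) (\<Sum>x\<in>S. weight x *\<^sub>R f x)"
    unfolding weight_def
    by (intro has_bochner_integral_sum has_bochner_integral_scaleR_left
        has_bochner_integral_real_indicator) (auto simp: sets_eq_UNIV emeasure_singleton)
  moreover have "(\<Sum>x\<in>S. indicator {x} y *\<^sub>R f x) = f y" for y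
  proof -
    have "(\<Sum>x\<in>S. indicator {x} y *\<^sub>R f x) = (\<Sum>x\<in>S. if y = x then f x else 0)"
      by (intro sum.cong) (auto simp: indicator_def)
    also have "\<dots> = f y" using assms by (auto simp: sum.delta)
    finally show ?thesis .
  qed
  ultimately show ?thesis by simp
qed

lemma integrable_finite_support:
  fixes f :: "'v \<Rightarrow> 'b::{banach, second_countable_topology}"
  assumes "finite S" "\<And>x. x \<notin> S \<Longrightarrow> f x = 0"
  shows "integrable M f"
  using has_integral_finite_support[of S f, OF assms] by (simp add: has_bochner_integral_iff)

lemma integral_finite_support:
  fixes f :: "'v \<Rightarrow> 'b::{banach, second_countable_topology}"
  assumes "finite S" "\<And>x. x \<notin> S \<Longrightarrow> f x = 0"
  shows "(\<integral>x. f x \<partial>M) = (\<Sum>x\<in>S. weight x *\<^sub>R f x)"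
  using has_integral_finite_support[of S f, OF assms] by (simp add: has_bochner_integral_iff)

lemma integral_restrict_finite:
  fixes f :: "'v \<Rightarrow> 'b::{banach, second_countable_topology}"
  assumes "finite S"
  shows "(LINT x:S|M. f x) = (\<Sum>x\<in>S. weight x *\<^sub>R f x)"
  unfolding set_lebesgue_integral_def
  by (subst integral_finite_support[OF assms]) (auto simp: indicator_def intro!: sum.cong)

lemma measure_eq_sum_weight: "finite S \<Longrightarrow> measure M S = sum weight S"
  using integral_restrict_finite[of S "\<lambda>_. 1 :: real"]
  by (simp add: set_lebesgue_integral_def space_eq_UNIV)

lemma measure_family_pos: "R \<in> \<R> \<Longrightarrow> 0 < measure M R"
  by (simp add: measure_eq_sum_weight finite_family nonempty_family sum_pos weight_pos)

lemma AE_iff_all: "(AE x in M. P x) \<longleftrightarrow> (\<forall>x. P x)"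
proof
  assume "AE x in M. P x"
  then have null: "{x. \<not> P x} \<in> null_sets M"
    by (auto simp: eventually_ae_filter space_eq_UNIV sets_eq_UNIV intro: null_sets_subset)
  show "\<forall>x. P x"
  proof (rule allI, rule ccontr)
    fix x assume "\<not> P x"
    then have "{x} \<in> null_sets M"
      using null by (auto intro: null_sets_subset simp: sets_eq_UNIV)
    then show False using emeasure_singleton(1)[of x] by auto
  qed
qed simp

section \<open>Atoms\<close>

text \<open>No point is a null set, so the essential supremum is a supremum and the conditions on an atom
  become pointwise bounds and a finite sum.\<close>

lemma atoms_infinity_iff:
  "a \<in> atoms M \<R> \<infinity> \<longleftrightarrow> (\<exists>R\<in>\<R>. (\<forall>x. x \<notin> R \<longrightarrow> a x = 0) \<and>
     (\<forall>x. cmod (a x) \<le> 1 / measure M R) \<and> (\<Sum>x\<in>R. weight x *\<^sub>R a x) = 0)"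
proof -
  have "Lp_norm M \<infinity> a \<le> ereal (measure M R powr (real_of_ereal (1 / \<infinity>) - 1)) \<longleftrightarrow>
      (\<forall>x. cmod (a x) \<le> 1 / measure M R)" if R: "R \<in> \<R>" for R
  proof -
    have "esssup M (\<lambda>x. ereal (cmod (a x))) \<le> ereal c \<longleftrightarrow> (\<forall>x. cmod (a x) \<le> c)" for c
    proof
      assume "esssup M (\<lambda>x. ereal (cmod (a x))) \<le> ereal c"
      moreover have "\<forall>x. ereal (cmod (a x)) \<le> esssup M (\<lambda>x. ereal (cmod (a x)))"
        using esssup_AE[of "\<lambda>x. ereal (cmod (a x))" M] unfolding AE_iff_all .
      ultimately show "\<forall>x. cmod (a x) \<le> c" using order_trans ereal_less_eq(3) by blast
    qed (auto intro!: esssup_I measurable_any)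
    then show ?thesis
      using measure_family_pos[OF R] by (simp add: Lp_norm_def powr_minus_divide)
  qed
  moreover have "has_bochner_integral M a 0 \<longleftrightarrow> (\<Sum>x\<in>R. weight x *\<^sub>R a x) = 0"
    if "R \<in> \<R>" "\<forall>x. x \<notin> R \<longrightarrow> a x = 0" for R
    using has_integral_finite_support[OF finite_family[OF that(1)], of a] that
      has_bochner_integral_eq by fastforce
  ultimately show ?thesis unfolding atoms_def by blast
qed

lemma atoms_two_I:
  assumes R: "R \<in> \<R>" and supp: "\<And>x. x \<notin> R \<Longrightarrow> a x = 0"
    and bound: "(\<Sum>x\<in>R. weight x * (cmod (a x))\<^sup>2) \<le> 1 / measure M R"
    and mean: "(\<Sum>x\<in>R. weight x *\<^sub>R a x) = 0"
  shows "a \<in> atoms M \<R> 2"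
proof -
  have pos: "0 < measure M R" by (rule measure_family_pos[OF R])
  have fin: "finite R" by (rule finite_family[OF R])
  let ?q = "\<lambda>x. cmod (a x) powr 2"
  have q: "?q x = (cmod (a x))\<^sup>2" for x by simp
  have "has_bochner_integral M ?q (\<Sum>x\<in>R. weight x *\<^sub>R ?q x)"
    by (rule has_integral_finite_support[OF fin]) (simp add: supp)
  then have int: "integrable M ?q" "(\<integral>x. ?q x \<partial>M) = (\<Sum>x\<in>R. weight x * (cmod (a x))\<^sup>2)"
    by (simp_all add: has_bochner_integral_iff)
  have "(\<integral>x. ?q x \<partial>M) powr (1 / 2) \<le> (1 / measure M R) powr (1 / 2)"
    unfolding int(2) using bound by (intro powr_mono2) (auto intro!: sum_nonneg simp: less_imp_le[OF weight_pos])
  also have "\<dots> = measure M R powr (1 / 2 - 1)"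
    using pos by (simp add: powr_divide powr_minus_divide)
  finally have "Lp_norm M 2 a \<le> ereal (measure M R powr (real_of_ereal (1 / 2) - 1))"
    using int(1) by (simp add: Lp_norm_def one_ereal_def)
  moreover have "has_bochner_integral M a 0"
    using has_integral_finite_support[OF fin, of a] supp mean by simp
  ultimately show ?thesis unfolding atoms_def using R supp by blast
qed

lemma atom_finite_support:
  assumes "a \<in> atoms M \<R> p"
  shows "finite {x. a x \<noteq> 0}"
proof -
  from assms obtain R where "R \<in> \<R>" "\<forall>x. x \<notin> R \<longrightarrow> a x = 0" unfolding atoms_def by blast
  then have "{x. a x \<noteq> 0} \<subseteq> R" "finite R" by (auto simp: finite_family)
  then show ?thesis by (rule finite_subset)
qed

lemma atom_mult_integrable:
  assumes "a \<in> atoms M \<R> p"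
  shows "integrable M (\<lambda>x. f x * a x)"
  by (rule integrable_finite_support[OF atom_finite_support[OF assms]]) simp

lemma atom_integral: "a \<in> atoms M \<R> p \<Longrightarrow> (\<integral>x. a x \<partial>M) = 0"
  unfolding atoms_def by (auto simp: has_bochner_integral_iff)

lemma zero_atom: "(\<lambda>_. 0) \<in> atoms M \<R> \<infinity>"
  unfolding atoms_infinity_iff using two_points by auto

text \<open>On a finite set every function is bounded, so normalisation is the only thing that separates
  a mean-zero function from an atom.\<close>

lemma mean_zero_eq_scaled_atom:
  assumes R: "R \<in> \<R>" and supp: "\<And>x. x \<notin> R \<Longrightarrow> g x = 0"
    and mean: "(\<Sum>x\<in>R. weight x *\<^sub>R g x) = 0"
  shows "\<exists>c a. a \<in> atoms M \<R> \<infinity> \<and> g = (\<lambda>x. c * a x)"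
proof -
  have pos: "0 < measure M R" by (rule measure_family_pos[OF R])
  define B where "B = 1 + (\<Sum>x\<in>R. cmod (g x))"
  have B: "0 < B" unfolding B_def by (simp add: add_pos_nonneg sum_nonneg)
  have gB: "cmod (g x) \<le> B" for x
  proof (cases "x \<in> R")
    case True
    then have "cmod (g x) \<le> (\<Sum>x\<in>R. cmod (g x))"
      by (intro member_le_sum) (auto simp: finite_family[OF R])
    then show ?thesis by (simp add: B_def)
  qed (use B supp in auto)
  define a where "a x = g x / complex_of_real (B * measure M R)" for x
  have "a \<in> atoms M \<R> \<infinity>"
    unfolding atoms_infinity_iff
  proof (intro bexI[OF _ R] conjI allI impI)
    show "a x = 0" if "x \<notin> R" for x using supp that by (simp add: a_def)
    show "cmod (a x) \<le> 1 / measure M R" for x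
      using gB[of x] B pos by (simp add: a_def norm_divide norm_mult divide_simps)
    have "(\<Sum>x\<in>R. weight x *\<^sub>R a x) =
        (\<Sum>x\<in>R. weight x *\<^sub>R g x) / complex_of_real (B * measure M R)"
      by (simp add: a_def sum_divide_distrib scaleR_conv_of_real)
    then show "(\<Sum>x\<in>R. weight x *\<^sub>R a x) = 0" using mean by simp
  qed
  moreover have "g = (\<lambda>x. complex_of_real (B * measure M R) * a x)"
    using B pos by (auto simp: a_def)
  ultimately show ?thesis by blast
qed

section \<open>Hardy spaces\<close>

lemma hardy_normI_le:
  assumes "atomic_decomposition M \<R> p g c a"
  shows "hardy_norm M \<R> p g \<le> (\<Sum>j. cmod (c j))"
  unfolding hardy_norm_def
  using assms by (intro cInf_lower) (auto intro!: bdd_belowI[of _ 0] suminf_nonneg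
      simp: atomic_decomposition_def)

lemma le_hardy_norm:
  assumes "g \<in> hardy M \<R> p"
    and "\<And>c a. atomic_decomposition M \<R> p g c a \<Longrightarrow> K \<le> (\<Sum>j. cmod (c j))"
  shows "K \<le> hardy_norm M \<R> p g"
  unfolding hardy_norm_def using assms by (intro cInf_greatest) (auto simp: hardy_def)

lemma hardy_norm_nonneg: "g \<in> hardy M \<R> p \<Longrightarrow> 0 \<le> hardy_norm M \<R> p g"
  by (rule le_hardy_norm) (auto simp: atomic_decomposition_def intro: suminf_nonneg)

lemma hardy_integrable: "g \<in> hardy M \<R> p \<Longrightarrow> integrable M g"
  by (auto simp: hardy_def atomic_decomposition_def)

lemma decomposition_finite_sum:
  fixes c :: "nat \<Rightarrow> complex"
  assumes "\<And>j. a j \<in> atoms M \<R> p"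
  shows "(\<lambda>x. \<Sum>j<n. c j * a j x) \<in> hardy M \<R> p"
    and "hardy_norm M \<R> p (\<lambda>x. \<Sum>j<n. c j * a j x) \<le> (\<Sum>j<n. cmod (c j))"
proof -
  define c' where "c' j = (if j < n then c j else 0)" for j
  have c': "(\<lambda>j. cmod (c' j)) sums (\<Sum>j<n. cmod (c j))"
  proof -
    have "(\<lambda>j. cmod (c' j)) = (\<lambda>j. if j \<in> {..<n} then cmod (c j) else 0)"
      by (auto simp: c'_def)
    then show ?thesis using sums_If_finite_set[of "{..<n}" "\<lambda>j. cmod (c j)"] by simp
  qed
  have dec: "atomic_decomposition M \<R> p (\<lambda>x. \<Sum>j<n. c j * a j x) c' a"
    unfolding atomic_decomposition_def
  proof (intro conjI allI)
    show "integrable M (\<lambda>x. \<Sum>j<n. c j * a j x)"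
      using assms by (intro Bochner_Integration.integrable_sum atom_mult_integrable)
    show "(\<lambda>k. \<integral>x. cmod ((\<Sum>j<n. c j * a j x) - (\<Sum>j<k. c' j * a j x)) \<partial>M) \<longlonglongrightarrow> 0"
    proof (rule tendsto_eventually, rule eventually_sequentiallyI)
      fix k assume "n \<le> k"
      have "(\<Sum>j<k. c' j * a j x) = (\<Sum>j<n. c j * a j x)" for x
        using \<open>n \<le> k\<close> by (intro sum.mono_neutral_cong_right) (auto simp: c'_def)
      then show "(\<integral>x. cmod ((\<Sum>j<n. c j * a j x) - (\<Sum>j<k. c' j * a j x)) \<partial>M) = 0" by simp
    qed
  qed (use assms c' in \<open>auto simp: sums_iff\<close>)
  then show "(\<lambda>x. \<Sum>j<n. c j * a j x) \<in> hardy M \<R> p" by (auto simp: hardy_def)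
  show "hardy_norm M \<R> p (\<lambda>x. \<Sum>j<n. c j * a j x) \<le> (\<Sum>j<n. cmod (c j))"
    using hardy_normI_le[OF dec] c' by (simp add: sums_iff)
qed

lemma scaled_atom_hardy:
  assumes "a \<in> atoms M \<R> p"
  shows "(\<lambda>x. c * a x) \<in> hardy M \<R> p" "hardy_norm M \<R> p (\<lambda>x. c * a x) \<le> cmod c"
  using decomposition_finite_sum[of "\<lambda>_. a" p "\<lambda>_. c" 1] assms by simp_all

lemma decomposition_remainder:
  assumes dec: "atomic_decomposition M \<R> p g c a"
  shows "(\<lambda>x. g x - (\<Sum>j<n. c j * a j x)) \<in> hardy M \<R> p"
    and "hardy_norm M \<R> p (\<lambda>x. g x - (\<Sum>j<n. c j * a j x)) \<le> (\<Sum>j. cmod (c (j + n)))"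
proof -
  note d = dec[unfolded atomic_decomposition_def]
  have dec': "atomic_decomposition M \<R> p (\<lambda>x. g x - (\<Sum>j<n. c j * a j x))
      (\<lambda>j. c (j + n)) (\<lambda>j. a (j + n))"
    unfolding atomic_decomposition_def
  proof (intro conjI allI)
    show "integrable M (\<lambda>x. g x - (\<Sum>j<n. c j * a j x))"
      using d by (intro Bochner_Integration.integrable_diff Bochner_Integration.integrable_sum
          atom_mult_integrable) auto
    have "(\<Sum>j<k + n. c j * a j x) = (\<Sum>j<n. c j * a j x) + (\<Sum>j<k. c (j + n) * a (j + n) x)"
      for k x
      by (induction k) (auto simp: algebra_simps)
    moreover have "(\<lambda>k. \<integral>x. cmod (g x - (\<Sum>j<k + n. c j * a j x)) \<partial>M) \<longlonglongrightarrow> 0"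
      using d by (intro LIMSEQ_ignore_initial_segment) auto
    ultimately show "(\<lambda>k. \<integral>x. cmod (g x - (\<Sum>j<n. c j * a j x) -
        (\<Sum>j<k. c (j + n) * a (j + n) x)) \<partial>M) \<longlonglongrightarrow> 0"
      by (simp add: diff_diff_eq)
  qed (use d in \<open>auto intro: summable_ignore_initial_segment\<close>)
  then show "(\<lambda>x. g x - (\<Sum>j<n. c j * a j x)) \<in> hardy M \<R> p" by (auto simp: hardy_def)
  show "hardy_norm M \<R> p (\<lambda>x. g x - (\<Sum>j<n. c j * a j x)) \<le> (\<Sum>j. cmod (c (j + n)))"
    by (rule hardy_normI_le[OF dec'])
qed

lemma hardy_scale:
  assumes "g \<in> hardy M \<R> p"
  shows "(\<lambda>x. t * g x) \<in> hardy M \<R> p"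
    and "hardy_norm M \<R> p (\<lambda>x. t * g x) \<le> cmod t * hardy_norm M \<R> p g"
proof -
  have dec: "atomic_decomposition M \<R> p (\<lambda>x. t * g x) (\<lambda>j. t * c j) a"
    if "atomic_decomposition M \<R> p g c a" for c a
  proof -
    note d = that[unfolded atomic_decomposition_def]
    have "t * g x - (\<Sum>j<n. t * c j * a j x) = t * (g x - (\<Sum>j<n. c j * a j x))" for n x
      by (simp add: algebra_simps sum_distrib_left)
    moreover have "(\<lambda>n. cmod t * (\<integral>x. cmod (g x - (\<Sum>j<n. c j * a j x)) \<partial>M)) \<longlonglongrightarrow> 0"
      using d by (intro tendsto_mult_right_zero) auto
    ultimately show ?thesis
      using d unfolding atomic_decomposition_def by (simp add: norm_mult summable_mult)
  qed
  then show "(\<lambda>x. t * g x) \<in> hardy M \<R> p"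
    using assms by (auto simp: hardy_def)
  show "hardy_norm M \<R> p (\<lambda>x. t * g x) \<le> cmod t * hardy_norm M \<R> p g"
  proof (cases "t = 0")
    case True
    obtain a where a: "a \<in> atoms M \<R> p"
      using assms by (auto simp: hardy_def atomic_decomposition_def)
    show ?thesis using scaled_atom_hardy(2)[OF a, of 0] True by simp
  next
    case False
    have "hardy_norm M \<R> p (\<lambda>x. t * g x) / cmod t \<le> hardy_norm M \<R> p g"
    proof (rule le_hardy_norm[OF assms])
      fix c a assume d: "atomic_decomposition M \<R> p g c a"
      then have "summable (\<lambda>j. cmod (c j))" by (simp add: atomic_decomposition_def)
      then show "hardy_norm M \<R> p (\<lambda>x. t * g x) / cmod t \<le> (\<Sum>j. cmod (c j))"
        using hardy_normI_le[OF dec[OF d]] False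
        by (simp add: norm_mult suminf_mult divide_simps mult.commute)
    qed
    then show ?thesis using False by (simp add: divide_simps mult.commute)
  qed
qed

lemma zero_in_unit_ball:
  "(\<lambda>_. 0) \<in> {g \<in> hardy M \<R> \<infinity>. hardy_norm M \<R> \<infinity> g \<le> 1}"
  using scaled_atom_hardy[OF zero_atom, of 0] by simp

lemma le_dual_norm:
  assumes L: "bounded_functional M \<R> L"
    and g: "g \<in> hardy M \<R> \<infinity>" "hardy_norm M \<R> \<infinity> g \<le> 1"
  shows "cmod (L g) \<le> dual_norm M \<R> L"
proof -
  obtain K where K: "\<And>g. g \<in> hardy M \<R> \<infinity> \<Longrightarrow> cmod (L g) \<le> K * hardy_norm M \<R> \<infinity> g"
    using L unfolding bounded_functional_def by blast
  have "bdd_above ((\<lambda>g. cmod (L g)) ` {g \<in> hardy M \<R> \<infinity>. hardy_norm M \<R> \<infinity> g \<le> 1})"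
  proof (rule bdd_aboveI2)
    fix g assume "g \<in> {g \<in> hardy M \<R> \<infinity>. hardy_norm M \<R> \<infinity> g \<le> 1}"
    then have g: "cmod (L g) \<le> K * hardy_norm M \<R> \<infinity> g"
      "0 \<le> hardy_norm M \<R> \<infinity> g" "hardy_norm M \<R> \<infinity> g \<le> 1"
      using K hardy_norm_nonneg by auto
    note g(1)
    also have "K * hardy_norm M \<R> \<infinity> g \<le> \<bar>K\<bar> * 1" using g by (intro mult_mono) auto
    finally show "cmod (L g) \<le> \<bar>K\<bar>" by simp
  qed
  then show ?thesis unfolding dual_norm_def using g by (intro cSUP_upper) auto
qed

lemma dual_norm_nonneg:
  assumes "bounded_functional M \<R> L"
  shows "0 \<le> dual_norm M \<R> L"
  using le_dual_norm[OF assms] zero_in_unit_ball order_trans[OF norm_ge_zero] by blast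

text \<open>The operator norm inequality, also when the Hardy norm of \<open>g\<close> vanishes, where
  normalising \<open>g\<close> is impossible and boundedness gives \<open>L g = 0\<close> directly.\<close>

lemma bounded_functional_le_dual_norm:
  assumes L: "bounded_functional M \<R> L" and g: "g \<in> hardy M \<R> \<infinity>"
  shows "cmod (L g) \<le> dual_norm M \<R> L * hardy_norm M \<R> \<infinity> g"
proof -
  let ?n = "hardy_norm M \<R> \<infinity>"
  show ?thesis
  proof (cases "?n g = 0")
    case True
    then show ?thesis using L g unfolding bounded_functional_def by fastforce
  next
    case False
    then have pos: "0 < ?n g" using hardy_norm_nonneg[OF g] by simp
    define h where "h = (\<lambda>x. complex_of_real (1 / ?n g) * g x)"
    have h: "h \<in> hardy M \<R> \<infinity>" "?n h \<le> 1"
      using hardy_scale[OF g, of "complex_of_real (1 / ?n g)"] pos by (auto simp: h_def norm_divide)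
    have "L h = complex_of_real (1 / ?n g) * L g"
      using L g unfolding bounded_functional_def h_def by blast
    then have "cmod (L h) = cmod (L g) / ?n g" using pos by (simp add: norm_mult norm_divide)
    then show ?thesis using le_dual_norm[OF L h] pos by (simp add: pos_divide_le_eq)
  qed
qed

text \<open>The remainder of an atomic series has a Hardy norm at most the tail of \<open>\<Sum>j. \<bar>c j\<bar>\<close>, so bounded
  functionals are evaluated term by term.\<close>

lemma bounded_functional_sums:
  assumes L: "bounded_functional M \<R> L" and dec: "atomic_decomposition M \<R> \<infinity> g c a"
  shows "(\<lambda>j. c j * L (a j)) sums L g"
proof -
  note d = dec[unfolded atomic_decomposition_def]
  have add: "L (\<lambda>x. g x + h x) = L g + L h" if "g \<in> hardy M \<R> \<infinity>" "h \<in> hardy M \<R> \<infinity>" for g h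
    using L that unfolding bounded_functional_def by blast
  have scale: "L (\<lambda>x. c * g x) = c * L g" if "g \<in> hardy M \<R> \<infinity>" for g c
    using L that unfolding bounded_functional_def by blast
  have atom: "a j \<in> hardy M \<R> \<infinity>" for j using scaled_atom_hardy(1)[of "a j" \<infinity> 1] d by simp
  let ?s = "\<lambda>n x. \<Sum>j<n. c j * a j x"
  have s: "?s n \<in> hardy M \<R> \<infinity>" for n by (rule decomposition_finite_sum(1)) (use d in blast)
  have Ls: "L (?s n) = (\<Sum>j<n. c j * L (a j))" for n
  proof (induction n)
    case 0
    then show ?case using scale[OF atom, of 0] by simp
  next
    case (Suc n)
    then show ?case
      using add[OF s hardy_scale(1)[OF atom], of n "c n" n] scale[OF atom] by simp
  qed
  let ?r = "\<lambda>n x. g x - ?s n x"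
  note r = decomposition_remainder[OF dec]
  have Lg: "L g = L (?s n) + L (?r n)" for n
    using add[OF s[of n] r(1)[of n]] by simp
  obtain K where K: "\<And>g. g \<in> hardy M \<R> \<infinity> \<Longrightarrow> cmod (L g) \<le> K * hardy_norm M \<R> \<infinity> g"
    using L unfolding bounded_functional_def by blast
  have "(\<lambda>n. L (?r n)) \<longlonglongrightarrow> 0"
  proof (rule Lim_null_comparison)
    show "\<forall>\<^sub>F n in sequentially. cmod (L (?r n)) \<le> \<bar>K\<bar> * (\<Sum>j. cmod (c (j + n)))"
    proof (intro always_eventually allI)
      fix n
      have "cmod (L (?r n)) \<le> K * hardy_norm M \<R> \<infinity> (?r n)" by (rule K[OF r(1)])
      also have "\<dots> \<le> \<bar>K\<bar> * hardy_norm M \<R> \<infinity> (?r n)"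
        by (intro mult_right_mono hardy_norm_nonneg[OF r(1)]) simp
      also have "\<dots> \<le> \<bar>K\<bar> * (\<Sum>j. cmod (c (j + n)))"
        by (intro mult_left_mono r(2)) simp
      finally show "cmod (L (?r n)) \<le> \<bar>K\<bar> * (\<Sum>j. cmod (c (j + n)))" .
    qed
    show "(\<lambda>n. \<bar>K\<bar> * (\<Sum>j. cmod (c (j + n)))) \<longlonglongrightarrow> 0"
      using d by (intro tendsto_mult_right_zero suminf_exist_split2) auto
  qed
  then have "(\<lambda>n. L g - L (?r n)) \<longlonglongrightarrow> L g - 0" by (intro tendsto_intros)
  moreover have "L g - L (?r n) = (\<Sum>j<n. c j * L (a j))" for n using Lg[of n] Ls[of n] by simp
  ultimately show ?thesis by (simp add: sums_def)
qed


section \<open>The functional defined by a BMO function\<close>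

text \<open>The atomic series gives the natural value \<open>\<Sum>j. c j * \<integral>f a j\<close> of the functional at \<open>g\<close>, but
  it depends a priori on the decomposition. For a bounded function the value is \<open>\<integral>f g\<close>, and
  the following truncations approximate \<open>f\<close> by bounded functions.\<close>

definition truncate :: "nat \<Rightarrow> complex \<Rightarrow> complex" where
  "truncate k = closest_point (cball 0 (real k))"

lemma truncate_lipschitz: "cmod (truncate k z - truncate k w) \<le> cmod (z - w)"
  using closest_point_lipschitz[of "cball 0 (real k)" z w]
  by (simp add: truncate_def dist_norm)

lemma truncate_bounded: "cmod (truncate k z) \<le> real k"
  using closest_point_in_set[of "cball 0 (real k)" z] by (simp add: truncate_def)

lemma truncate_eq: "cmod z \<le> real k \<Longrightarrow> truncate k z = z"
  by (simp add: truncate_def closest_point_self)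

lemma eventually_truncate_eq: "\<forall>\<^sub>F k in sequentially. truncate k z = z"
  using eventually_ge_at_top[of "nat \<lceil>cmod z\<rceil>"]
  by (rule eventually_mono) (simp add: truncate_eq nat_le_iff ceiling_le_iff)

lemma truncated_integral_eventually:
  assumes "finite {x. g x \<noteq> 0}"
  shows "\<forall>\<^sub>F k in sequentially. (\<integral>x. truncate k (f x) * g x \<partial>M) = (\<integral>x. f x * g x \<partial>M)"
proof -
  have "\<forall>\<^sub>F k in sequentially. \<forall>x\<in>{x. g x \<noteq> 0}. truncate k (f x) = f x"
    using assms by (intro eventually_ball_finite ballI eventually_truncate_eq)
  then show ?thesis
  proof (rule eventually_mono)
    fix k assume "\<forall>x\<in>{x. g x \<noteq> 0}. truncate k (f x) = f x"
    then have "(\<lambda>x. truncate k (f x) * g x) = (\<lambda>x. f x * g x)" by fastforce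
    then show "(\<integral>x. truncate k (f x) * g x \<partial>M) = (\<integral>x. f x * g x \<partial>M)" by simp
  qed
qed

lemma mean_oscillation_eq_sum:
  assumes "R \<in> \<R>"
  shows "mean_oscillation M f R =
    (\<Sum>x\<in>R. weight x * cmod (f x - average M f R)) / measure M R"
  by (simp add: mean_oscillation_def integral_restrict_finite[OF finite_family[OF assms]])

lemma sum_diff_average:
  assumes "R \<in> \<R>"
  shows "(\<Sum>x\<in>R. weight x *\<^sub>R (f x - average M f R)) = 0"
proof -
  have fin: "finite R" by (rule finite_family[OF assms])
  have "(\<Sum>x\<in>R. weight x *\<^sub>R average M f R) = measure M R *\<^sub>R average M f R"
    by (simp add: measure_eq_sum_weight[OF fin] scaleR_sum_left)
  also have "\<dots> = (\<Sum>x\<in>R. weight x *\<^sub>R f x)"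
    using measure_family_pos[OF assms]
    by (simp add: average_def integral_restrict_finite[OF fin] scaleR_conv_of_real)
  finally have "(\<Sum>x\<in>R. weight x *\<^sub>R average M f R) = (\<Sum>x\<in>R. weight x *\<^sub>R f x)" .
  then show ?thesis by (simp add: algebra_simps sum_subtractf)
qed

lemma mean_oscillation_le_seminorm:
  "f \<in> BMO_functions M \<R> \<Longrightarrow> R \<in> \<R> \<Longrightarrow> mean_oscillation M f R \<le> BMO_seminorm M \<R> f"
  unfolding BMO_seminorm_def BMO_functions_def by (auto intro: cSUP_upper)

text \<open>Since an atom has mean zero, the value of \<open>\<phi>\<close> at the average of \<open>f\<close> may be subtracted from
  \<open>\<phi> (f x)\<close>; the Lipschitz bound then leaves the oscillation of \<open>f\<close> itself. In particular the
  pairings of all truncations of \<open>f\<close> with all atoms have a common bound.\<close>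

lemma lipschitz_atom_pairing_le:
  assumes f: "f \<in> BMO_functions M \<R>" and a: "a \<in> atoms M \<R> \<infinity>"
    and lip: "\<And>z w. cmod (\<phi> z - \<phi> w) \<le> cmod (z - w)"
  shows "cmod (\<integral>x. \<phi> (f x) * a x \<partial>M) \<le> BMO_seminorm M \<R> f"
proof -
  obtain R where R: "R \<in> \<R>" and supp: "\<And>x. x \<notin> R \<Longrightarrow> a x = 0"
    and bound: "\<And>x. cmod (a x) \<le> 1 / measure M R" and mean: "(\<Sum>x\<in>R. weight x *\<^sub>R a x) = 0"
    using a unfolding atoms_infinity_iff by blast
  have fin: "finite R" by (rule finite_family[OF R])
  let ?A = "average M f R"
  have "(\<integral>x. \<phi> (f x) * a x \<partial>M) = (\<Sum>x\<in>R. weight x *\<^sub>R (\<phi> (f x) * a x))"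
    by (rule integral_finite_support[OF fin]) (simp add: supp)
  also have "\<dots> = (\<Sum>x\<in>R. weight x *\<^sub>R ((\<phi> (f x) - \<phi> ?A) * a x)) + \<phi> ?A * (\<Sum>x\<in>R. weight x *\<^sub>R a x)"
    by (simp add: sum_distrib_left algebra_simps flip: sum.distrib)
  also have "\<dots> = (\<Sum>x\<in>R. weight x *\<^sub>R ((\<phi> (f x) - \<phi> ?A) * a x))" by (simp add: mean)
  also have "cmod \<dots> \<le> (\<Sum>x\<in>R. weight x * (cmod (f x - ?A) * (1 / measure M R)))"
  proof (rule order_trans[OF norm_sum], rule sum_mono)
    fix x
    have "cmod (\<phi> (f x) - \<phi> ?A) * cmod (a x) \<le> cmod (f x - ?A) * (1 / measure M R)"
      by (intro mult_mono lip bound) auto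
    then show "cmod (weight x *\<^sub>R ((\<phi> (f x) - \<phi> ?A) * a x))
        \<le> weight x * (cmod (f x - ?A) * (1 / measure M R))"
      unfolding norm_scaleR norm_mult abs_of_pos[OF weight_pos]
      by (rule mult_left_mono) (rule less_imp_le[OF weight_pos])
  qed
  also have "\<dots> = mean_oscillation M f R"
    by (simp add: mean_oscillation_eq_sum[OF R] sum_divide_distrib)
  also have "\<dots> \<le> BMO_seminorm M \<R> f" by (rule mean_oscillation_le_seminorm[OF f R])
  finally show ?thesis .
qed

lemma seminorm_nonneg: "f \<in> BMO_functions M \<R> \<Longrightarrow> 0 \<le> BMO_seminorm M \<R> f"
  using lipschitz_atom_pairing_le[OF _ zero_atom, of f "\<lambda>z. z"] by simp

lemma integrable_bounded_mult:
  fixes g u :: "'v \<Rightarrow> complex"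
  assumes g: "integrable M g" and bound: "\<And>x. cmod (u x) \<le> B"
  shows "integrable M (\<lambda>x. u x * g x)"
proof (rule Bochner_Integration.integrable_bound[where f = "\<lambda>x. B * cmod (g x)"])
  show "AE x in M. cmod (u x * g x) \<le> norm (B * cmod (g x))"
  proof (rule AE_I2)
    fix x
    have "cmod (u x * g x) \<le> B * cmod (g x)"
      unfolding norm_mult by (intro mult_right_mono bound) simp
    then show "cmod (u x * g x) \<le> norm (B * cmod (g x))" by simp
  qed
qed (use g measurable_any in auto)

text \<open>Partial sums converge to \<open>g\<close> in \<open>L\<^sup>1\<close>, and a bounded \<open>u\<close> preserves this convergence.\<close>

lemma bounded_pairing_sums:
  assumes dec: "atomic_decomposition M \<R> p g c a" and bound: "\<And>x. cmod (u x) \<le> B"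
  shows "(\<lambda>j. c j * (\<integral>x. u x * a j x \<partial>M)) sums (\<integral>x. u x * g x \<partial>M)"
proof -
  note d = dec[unfolded atomic_decomposition_def]
  let ?s = "\<lambda>n x. \<Sum>j<n. c j * a j x"
  note ug = integrable_bounded_mult[OF _ bound]
  have s: "integrable M (?s n)" for n
    using d by (intro Bochner_Integration.integrable_sum atom_mult_integrable) auto
  have us: "(\<integral>x. u x * ?s n x \<partial>M) = (\<Sum>j<n. c j * (\<integral>x. u x * a j x \<partial>M))" for n
  proof -
    have "(\<integral>x. u x * ?s n x \<partial>M) = (\<integral>x. (\<Sum>j<n. c j * (u x * a j x)) \<partial>M)"
      by (simp add: sum_distrib_left mult.left_commute)
    also have "\<dots> = (\<Sum>j<n. \<integral>x. c j * (u x * a j x) \<partial>M)"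
      using d by (intro Bochner_Integration.integral_sum integrable_mult_right atom_mult_integrable) auto
    finally show ?thesis by simp
  qed
  have "(\<lambda>n. (\<integral>x. u x * g x \<partial>M) - (\<integral>x. u x * ?s n x \<partial>M)) \<longlonglongrightarrow> 0"
  proof (rule Lim_null_comparison)
    show "\<forall>\<^sub>F n in sequentially. cmod ((\<integral>x. u x * g x \<partial>M) - (\<integral>x. u x * ?s n x \<partial>M))
        \<le> B * (\<integral>x. cmod (g x - ?s n x) \<partial>M)"
    proof (intro always_eventually allI)
      fix n
      have gs: "integrable M (\<lambda>x. g x - ?s n x)" using d s by auto
      have "(\<integral>x. u x * g x \<partial>M) - (\<integral>x. u x * ?s n x \<partial>M) = (\<integral>x. u x * (g x - ?s n x) \<partial>M)"
        using ug[of g] ug[OF s] d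
        by (subst Bochner_Integration.integral_diff[symmetric]) (auto simp: algebra_simps)
      also have "cmod \<dots> \<le> (\<integral>x. B * cmod (g x - ?s n x) \<partial>M)"
      proof (rule order_trans[OF integral_norm_bound], rule integral_mono)
        show "integrable M (\<lambda>x. cmod (u x * (g x - ?s n x)))"
          by (intro integrable_norm ug[OF gs])
        show "integrable M (\<lambda>x. B * cmod (g x - ?s n x))"
          by (intro integrable_mult_right integrable_norm gs)
        show "cmod (u x * (g x - ?s n x)) \<le> B * cmod (g x - ?s n x)" for x
          unfolding norm_mult by (intro mult_right_mono bound) simp
      qed
      finally show "cmod ((\<integral>x. u x * g x \<partial>M) - (\<integral>x. u x * ?s n x \<partial>M))
        \<le> B * (\<integral>x. cmod (g x - ?s n x) \<partial>M)" by simp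
    qed
    show "(\<lambda>n. B * (\<integral>x. cmod (g x - ?s n x) \<partial>M)) \<longlonglongrightarrow> 0"
      using d by (intro tendsto_mult_right_zero) auto
  qed
  then have "(\<lambda>n. (\<integral>x. u x * g x \<partial>M) - ((\<integral>x. u x * g x \<partial>M) - (\<integral>x. u x * ?s n x \<partial>M)))
      \<longlonglongrightarrow> (\<integral>x. u x * g x \<partial>M) - 0"
    by (intro tendsto_intros)
  then show ?thesis by (simp add: sums_def us)
qed

text \<open>Truncation at level \<open>k\<close> gives \<open>\<integral>truncate k (f x) * g x = \<Sum>j. c j * \<integral>truncate k (f x) * a j x\<close>. Each
  summand is eventually constant in \<open>k\<close>, and all are dominated by \<open>\<bar>c j\<bar>\<close> times the seminorm of
  \<open>f\<close>, so Tannery's theorem applies. The left-hand side knows nothing about the decomposition;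
  this makes the value well defined.\<close>

lemma truncated_pairing_tendsto:
  assumes f: "f \<in> BMO_functions M \<R>" and dec: "atomic_decomposition M \<R> \<infinity> g c a"
  shows "(\<lambda>k. \<integral>x. truncate k (f x) * g x \<partial>M) \<longlonglongrightarrow> (\<Sum>j. c j * (\<integral>x. f x * a j x \<partial>M))"
proof -
  note d = dec[unfolded atomic_decomposition_def]
  let ?t = "\<lambda>j k. c j * (\<integral>x. truncate k (f x) * a j x \<partial>M)"
  have bound: "cmod (?t j k) \<le> cmod (c j) * BMO_seminorm M \<R> f" for j k
    using lipschitz_atom_pairing_le[OF f, of "a j" "truncate k"] d truncate_lipschitz
    by (auto simp: norm_mult intro: mult_left_mono)
  have "(\<lambda>k. \<Sum>j. ?t j k) \<longlonglongrightarrow> (\<Sum>j. c j * (\<integral>x. f x * a j x \<partial>M))"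
  proof (rule tannerys_theorem[THEN conjunct2, THEN conjunct2])
    show "(\<lambda>k. ?t j k) \<longlonglongrightarrow> c j * (\<integral>x. f x * a j x \<partial>M)" for j
    proof -
      have "finite {x. a j x \<noteq> 0}" using d atom_finite_support by blast
      from truncated_integral_eventually[OF this, of f] show ?thesis
        by (intro tendsto_mult_left tendsto_eventually)
    qed
    show "\<forall>\<^sub>F (j, k) in sequentially \<times>\<^sub>F sequentially.
        cmod (?t j k) \<le> cmod (c j) * BMO_seminorm M \<R> f"
      using bound by (intro always_eventually) auto
    show "summable (\<lambda>j. cmod (c j) * BMO_seminorm M \<R> f)"
      using d by (intro summable_mult2) auto
  qed simp
  moreover have "(\<Sum>j. ?t j k) = (\<integral>x. truncate k (f x) * g x \<partial>M)" for k
    using bounded_pairing_sums[OF dec truncate_bounded[of k], of f] by (simp add: sums_iff)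
  ultimately show ?thesis by simp
qed

text \<open>Defining the functional through truncations makes it linear in \<open>g\<close> by construction.\<close>

definition pairing :: "('v \<Rightarrow> complex) \<Rightarrow> ('v \<Rightarrow> complex) \<Rightarrow> complex" where
  "pairing f g = lim (\<lambda>k. \<integral>x. truncate k (f x) * g x \<partial>M)"

lemma pairing_eq_suminf:
  assumes "f \<in> BMO_functions M \<R>" "atomic_decomposition M \<R> \<infinity> g c a"
  shows "pairing f g = (\<Sum>j. c j * (\<integral>x. f x * a j x \<partial>M))"
  unfolding pairing_def by (rule limI[OF truncated_pairing_tendsto[OF assms]])

lemma tendsto_pairing:
  assumes "f \<in> BMO_functions M \<R>" "g \<in> hardy M \<R> \<infinity>"
  shows "(\<lambda>k. \<integral>x. truncate k (f x) * g x \<partial>M) \<longlonglongrightarrow> pairing f g"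
proof -
  obtain c a where "atomic_decomposition M \<R> \<infinity> g c a" using assms(2) by (auto simp: hardy_def)
  from truncated_pairing_tendsto[OF assms(1) this] pairing_eq_suminf[OF assms(1) this]
  show ?thesis by simp
qed

lemma pairing_finite_support:
  assumes "finite {x. g x \<noteq> 0}"
  shows "pairing f g = (\<integral>x. f x * g x \<partial>M)"
  unfolding pairing_def
  by (rule limI[OF tendsto_eventually[OF truncated_integral_eventually[OF assms]]])

lemma pairing_le:
  assumes f: "f \<in> BMO_functions M \<R>" and g: "g \<in> hardy M \<R> \<infinity>"
  shows "cmod (pairing f g) \<le> BMO_seminorm M \<R> f * hardy_norm M \<R> \<infinity> g"
proof -
  let ?B = "BMO_seminorm M \<R> f"
  have le: "cmod (pairing f g) \<le> ?B * (\<Sum>j. cmod (c j))" if dec: "atomic_decomposition M \<R> \<infinity> g c a" for c a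
  proof -
    note d = dec[unfolded atomic_decomposition_def]
    have bound: "cmod (c j * (\<integral>x. f x * a j x \<partial>M)) \<le> ?B * cmod (c j)" for j
      using lipschitz_atom_pairing_le[OF f, of "a j" "\<lambda>z. z"] d
      by (auto simp: norm_mult mult.commute intro: mult_left_mono)
    have sm: "summable (\<lambda>j. ?B * cmod (c j))" using d by (intro summable_mult) auto
    have "cmod (pairing f g) \<le> (\<Sum>j. ?B * cmod (c j))"
      unfolding pairing_eq_suminf[OF f dec] by (rule norm_suminf_le[OF bound sm])
    then show ?thesis using d by (simp add: suminf_mult)
  qed
  show ?thesis
  proof (cases "?B = 0")
    case True
    then show ?thesis using le g by (auto simp: hardy_def)
  next
    case False
    then have "0 < ?B" using seminorm_nonneg[OF f] by simp
    then have "cmod (pairing f g) / ?B \<le> hardy_norm M \<R> \<infinity> g"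
      using le by (intro le_hardy_norm[OF g]) (simp add: divide_simps mult.commute)
    then show ?thesis using \<open>0 < ?B\<close> by (simp add: divide_simps mult.commute)
  qed
qed

lemma bounded_functional_pairing:
  assumes f: "f \<in> BMO_functions M \<R>"
  shows "bounded_functional M \<R> (pairing f)"
  unfolding bounded_functional_def
proof (intro conjI ballI allI)
  note int = integrable_bounded_mult[OF hardy_integrable truncate_bounded]
  fix g assume g: "g \<in> hardy M \<R> \<infinity>"
  show "pairing f (\<lambda>x. c * g x) = c * pairing f g" for c
  proof -
    have "(\<lambda>k. c * (\<integral>x. truncate k (f x) * g x \<partial>M)) \<longlonglongrightarrow> c * pairing f g"
      by (intro tendsto_mult_left tendsto_pairing f g)
    moreover have "c * (\<integral>x. truncate k (f x) * g x \<partial>M) = (\<integral>x. truncate k (f x) * (c * g x) \<partial>M)" for k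
      by (simp add: mult.left_commute)
    ultimately show ?thesis unfolding pairing_def[of f "\<lambda>x. c * g x"] by (simp add: limI)
  qed
  fix h assume h: "h \<in> hardy M \<R> \<infinity>"
  have "(\<lambda>k. (\<integral>x. truncate k (f x) * g x \<partial>M) + (\<integral>x. truncate k (f x) * h x \<partial>M))
      \<longlonglongrightarrow> pairing f g + pairing f h"
    by (intro tendsto_add tendsto_pairing f g h)
  moreover have "(\<integral>x. truncate k (f x) * g x \<partial>M) + (\<integral>x. truncate k (f x) * h x \<partial>M) =
      (\<integral>x. truncate k (f x) * (g x + h x) \<partial>M)" for k
    unfolding distrib_left by (rule Bochner_Integration.integral_add[symmetric]) (rule int[OF g] int[OF h])+
  ultimately show "pairing f (\<lambda>x. g x + h x) = pairing f g + pairing f h"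
    unfolding pairing_def[of f "\<lambda>x. g x + h x"] by (simp add: limI)
next
  show "\<exists>K. \<forall>g\<in>hardy M \<R> \<infinity>. cmod (pairing f g) \<le> K * hardy_norm M \<R> \<infinity> g"
    using pairing_le[OF f] by blast
qed

lemma dual_norm_pairing_le:
  assumes f: "f \<in> BMO_functions M \<R>"
  shows "dual_norm M \<R> (pairing f) \<le> BMO_seminorm M \<R> f"
  unfolding dual_norm_def
proof (rule cSUP_least)
  fix g assume g: "g \<in> {g \<in> hardy M \<R> \<infinity>. hardy_norm M \<R> \<infinity> g \<le> 1}"
  then have "cmod (pairing f g) \<le> BMO_seminorm M \<R> f * hardy_norm M \<R> \<infinity> g"
    by (intro pairing_le f) auto
  also have "\<dots> \<le> BMO_seminorm M \<R> f"
    using g seminorm_nonneg[OF f] by (intro mult_left_le) auto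
  finally show "cmod (pairing f g) \<le> BMO_seminorm M \<R> f" .
qed (use zero_in_unit_ball in blast)

lemma hardy_fin_finite_support:
  assumes "g \<in> hardy_fin M \<R> \<infinity>"
  shows "finite {x. g x \<noteq> 0}"
proof -
  from assms obtain n :: nat and c a where g: "g = (\<lambda>x. \<Sum>j<n. c j * a j x)"
    and a: "\<And>j. j < n \<Longrightarrow> a j \<in> atoms M \<R> \<infinity>"
    unfolding hardy_fin_def by blast
  have "{x. g x \<noteq> 0} \<subseteq> (\<Union>j<n. {x. a j x \<noteq> 0})"
    unfolding g by (auto elim!: sum.not_neutral_contains_not_neutral)
  then show ?thesis by (rule finite_subset) (use a atom_finite_support in auto)
qed

section \<open>Recovering the BMO function from a functional\<close>

text \<open>Testing \<open>f - average f\<close> against its conjugate sign \<open>\<psi>\<close> gives the mean oscillation, and since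
  \<open>f - average f\<close> has mean zero, \<open>\<psi>\<close> may be replaced by \<open>\<psi> - average \<psi>\<close>, which is supported
  on \<open>R\<close> and has mean zero. Subtracting the average does not increase the \<open>L\<^sup>2\<close> norm, while
  it may double the \<open>L\<^sup>\<infinity>\<close> norm. So the test function is a \<open>(1,2)\<close>-atom but only
  twice a \<open>(1,\<infinity>)\<close>-atom; this is how the constant \<open>C\<^sub>2\<close> enters.\<close>

lemma mean_oscillation_tested_by_atom:
  assumes R: "R \<in> \<R>"
  shows "\<exists>b. (\<lambda>x. b x / 2) \<in> atoms M \<R> \<infinity> \<and> b \<in> atoms M \<R> 2 \<and>
    complex_of_real (mean_oscillation M f R) = (\<integral>x. f x * b x \<partial>M)"
proof -
  have fin: "finite R" by (rule finite_family[OF R])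
  have pos: "0 < measure M R" by (rule measure_family_pos[OF R])
  have w0: "0 \<le> weight x" for x by (rule less_imp_le[OF weight_pos])
  define u where "u x = f x - average M f R" for x
  define \<psi> where "\<psi> x = cnj (sgn (u x))" for x
  define A where "A = average M \<psi> R"
  define b where "b x = (if x \<in> R then (\<psi> x - A) / complex_of_real (measure M R) else 0)" for x
  have \<psi>1: "cmod (\<psi> x) \<le> 1" for x by (simp add: \<psi>_def norm_sgn)
  have sum_u: "(\<Sum>x\<in>R. weight x *\<^sub>R u x) = 0"
    using sum_diff_average[OF R, of f] by (simp add: u_def)
  have sum_\<psi>: "(\<Sum>x\<in>R. weight x *\<^sub>R (\<psi> x - A)) = 0"
    using sum_diff_average[OF R, of \<psi>] by (simp add: A_def)
  have sum_b: "(\<Sum>x\<in>R. weight x *\<^sub>R b x) = 0"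
  proof -
    have "(\<Sum>x\<in>R. weight x *\<^sub>R b x) = (\<Sum>x\<in>R. weight x *\<^sub>R (\<psi> x - A)) / complex_of_real (measure M R)"
      unfolding sum_divide_distrib by (rule sum.cong) (auto simp: b_def scaleR_conv_of_real)
    then show ?thesis by (simp add: sum_\<psi>)
  qed
  have A1: "cmod A \<le> 1"
  proof -
    have "cmod (\<Sum>x\<in>R. weight x *\<^sub>R \<psi> x) \<le> (\<Sum>x\<in>R. weight x * 1)"
      by (rule order_trans[OF norm_sum], rule sum_mono) (simp add: w0 mult_left_le \<psi>1)
    also have "\<dots> = measure M R" by (simp add: measure_eq_sum_weight[OF fin])
    finally show ?thesis
      using pos by (simp add: A_def average_def integral_restrict_finite[OF fin] norm_divide)
  qed
  have "(\<lambda>x. b x / 2) \<in> atoms M \<R> \<infinity>"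
    unfolding atoms_infinity_iff
  proof (intro bexI[OF _ R] conjI allI impI)
    show "cmod (b x / 2) \<le> 1 / measure M R" for x
      using norm_triangle_ineq4[of "\<psi> x" A] \<psi>1[of x] A1 pos
      by (simp add: b_def norm_divide divide_right_mono)
    show "(\<Sum>x\<in>R. weight x *\<^sub>R (b x / 2)) = 0"
      using sum_b by (simp add: scaleR_conv_of_real flip: sum_divide_distrib)
  qed (simp add: b_def)
  moreover have "b \<in> atoms M \<R> 2"
  proof (rule atoms_two_I[OF R _ _ sum_b])
    have "(cmod (\<psi> x - A))\<^sup>2 = (cmod (\<psi> x))\<^sup>2 - (cmod A)\<^sup>2 - 2 * Re (cnj A * (\<psi> x - A))" for x
      unfolding cmod_power2 by (simp add: power2_eq_square algebra_simps)
    then have "weight x * (cmod (\<psi> x - A))\<^sup>2 = weight x * (cmod (\<psi> x))\<^sup>2 - weight x * (cmod A)\<^sup>2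
        - 2 * Re (cnj A * (weight x *\<^sub>R (\<psi> x - A)))" for x
      by (simp only: right_diff_distrib mult_scaleR_right scaleR_complex.sel mult.left_commute)
    then have "(\<Sum>x\<in>R. weight x * (cmod (\<psi> x - A))\<^sup>2) =
        (\<Sum>x\<in>R. weight x * (cmod (\<psi> x))\<^sup>2) - (\<Sum>x\<in>R. weight x * (cmod A)\<^sup>2)
          - (\<Sum>x\<in>R. 2 * Re (cnj A * (weight x *\<^sub>R (\<psi> x - A))))"
      by (simp only: sum_subtractf)
    also have "(\<Sum>x\<in>R. 2 * Re (cnj A * (weight x *\<^sub>R (\<psi> x - A)))) =
        2 * Re (cnj A * (\<Sum>x\<in>R. weight x *\<^sub>R (\<psi> x - A)))"
      by (simp only: sum_distrib_left Re_sum)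
    also have "\<dots> = 0" by (simp add: sum_\<psi>)
    also have "(\<Sum>x\<in>R. weight x * (cmod (\<psi> x))\<^sup>2) - (\<Sum>x\<in>R. weight x * (cmod A)\<^sup>2) - 0
        \<le> (\<Sum>x\<in>R. weight x * (cmod (\<psi> x))\<^sup>2)"
      by (simp add: sum_nonneg w0)
    also have "\<dots> \<le> (\<Sum>x\<in>R. weight x)"
      by (intro sum_mono mult_left_le w0) (simp add: \<psi>1 power_le_one)
    finally have le: "(\<Sum>x\<in>R. weight x * (cmod (\<psi> x - A))\<^sup>2) \<le> measure M R"
      by (simp add: measure_eq_sum_weight[OF fin])
    have "(\<Sum>x\<in>R. weight x * (cmod (b x))\<^sup>2) =
        (\<Sum>x\<in>R. weight x * (cmod (\<psi> x - A))\<^sup>2) / (measure M R)\<^sup>2"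
      unfolding sum_divide_distrib by (rule sum.cong) (auto simp: b_def norm_divide power_divide)
    also have "\<dots> \<le> measure M R / (measure M R)\<^sup>2" using le by (rule divide_right_mono) simp
    finally show "(\<Sum>x\<in>R. weight x * (cmod (b x))\<^sup>2) \<le> 1 / measure M R"
      using pos by (simp add: power2_eq_square)
  qed (simp add: b_def)
  moreover have "complex_of_real (mean_oscillation M f R) = (\<integral>x. f x * b x \<partial>M)"
  proof -
    have u\<psi>: "u x * \<psi> x = complex_of_real (cmod (u x))" for x
      by (cases "u x = 0")
        (simp_all add: \<psi>_def sgn_eq complex_norm_square[symmetric] power2_eq_square)
    have "(\<integral>x. f x * b x \<partial>M) = (\<Sum>x\<in>R. weight x *\<^sub>R (f x * b x))"
      by (rule integral_finite_support[OF fin]) (simp add: b_def)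
    also have "\<dots> = (\<Sum>x\<in>R. weight x *\<^sub>R (u x * b x)) + average M f R * (\<Sum>x\<in>R. weight x *\<^sub>R b x)"
      by (simp add: u_def sum_distrib_left algebra_simps flip: sum.distrib)
    also have "\<dots> = (\<Sum>x\<in>R. weight x *\<^sub>R (u x * b x))" by (simp add: sum_b)
    also have "\<dots> = (\<Sum>x\<in>R. weight x *\<^sub>R (u x * (\<psi> x - A))) / complex_of_real (measure M R)"
      unfolding sum_divide_distrib by (rule sum.cong) (auto simp: b_def scaleR_conv_of_real)
    also have "(\<Sum>x\<in>R. weight x *\<^sub>R (u x * (\<psi> x - A))) =
        (\<Sum>x\<in>R. weight x *\<^sub>R (u x * \<psi> x)) - A * (\<Sum>x\<in>R. weight x *\<^sub>R u x)"
      by (simp add: sum_distrib_left algebra_simps flip: sum_subtractf)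
    also have "\<dots> = complex_of_real (\<Sum>x\<in>R. weight x * cmod (u x))"
      unfolding sum_u u\<psi> by (simp add: scaleR_conv_of_real)
    finally show ?thesis by (simp add: mean_oscillation_eq_sum[OF R] u_def)
  qed
  ultimately show ?thesis by blast
qed

definition dipole :: "'v \<Rightarrow> 'v \<Rightarrow> 'v \<Rightarrow> complex" where
  "dipole x y = (\<lambda>z. indicator {x} z / complex_of_real (weight x)
                  - indicator {y} z / complex_of_real (weight y))"

lemma sum_mult_dipole:
  assumes "finite R" "x \<in> R" "y \<in> R"
  shows "(\<Sum>z\<in>R. weight z *\<^sub>R (f z * dipole x y z)) = f x - f y"
proof -
  have *: "(\<Sum>z\<in>R. weight z *\<^sub>R (f z * (indicator {x} z / complex_of_real (weight x)))) = f x"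
    if "x \<in> R" for x
  proof -
    have "(\<Sum>z\<in>R. weight z *\<^sub>R (f z * (indicator {x} z / complex_of_real (weight x)))) =
        (\<Sum>z\<in>R. if z = x then f z else 0)"
      using weight_pos[of x] by (intro sum.cong) (auto simp: scaleR_conv_of_real)
    then show ?thesis using that assms(1) by simp
  qed
  show ?thesis
    using *[OF assms(2)] *[OF assms(3)]
    by (simp add: dipole_def right_diff_distrib scaleR_diff_right sum_subtractf)
qed

lemma dipole_scaled_atom: "\<exists>c a. a \<in> atoms M \<R> \<infinity> \<and> dipole x y = (\<lambda>z. c * a z)"
proof -
  obtain R where R: "R \<in> \<R>" "x \<in> R" "y \<in> R" using two_points by blast
  show ?thesis
  proof (rule mean_zero_eq_scaled_atom[OF R(1)])
    show "dipole x y z = 0" if "z \<notin> R" for z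
      using that R by (auto simp: dipole_def indicator_def)
    show "(\<Sum>z\<in>R. weight z *\<^sub>R dipole x y z) = 0"
      using sum_mult_dipole[OF finite_family[OF R(1)] R(2,3), of "\<lambda>_. 1"] by simp
  qed
qed

text \<open>A functional \<open>L\<close> must be given by \<open>f\<close> with \<open>f x - f y = L (dipole x y)\<close>, which determines \<open>f\<close>
  up to the choice of its value at one vertex. Conversely an atom \<open>a\<close> on \<open>R\<close> is a finite
  combination of dipoles, because \<open>a = (\<Sum>x\<in>R. weight x * a x * dipole x r)\<close> for any \<open>r \<in> R\<close>.\<close>

lemma bounded_functional_represented_on_atoms:
  assumes L: "bounded_functional M \<R> L"
  shows "\<exists>f. \<forall>a\<in>atoms M \<R> \<infinity>. L a = (\<integral>x. f x * a x \<partial>M)"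
proof -
  have add: "L (\<lambda>x. g x + h x) = L g + L h" if "g \<in> hardy M \<R> \<infinity>" "h \<in> hardy M \<R> \<infinity>" for g h
    using L that unfolding bounded_functional_def by blast
  have scale: "L (\<lambda>x. c * g x) = c * L g" if "g \<in> hardy M \<R> \<infinity>" for g c
    using L that unfolding bounded_functional_def by blast
  have dipole: "dipole x y \<in> hardy M \<R> \<infinity>" for x y
    using dipole_scaled_atom[of x y] scaled_atom_hardy(1) by fastforce
  fix o' :: 'v
  define f where "f x = L (dipole x o')" for x
  have diff: "L (dipole x y) = f x - f y" for x y
  proof -
    have "dipole x o' = (\<lambda>z. dipole x y z + dipole y o' z)" by (auto simp: dipole_def)
    then show ?thesis using add[OF dipole[of x y] dipole[of y o']] by (simp add: f_def)
  qed
  have "L a = (\<integral>x. f x * a x \<partial>M)" if a: "a \<in> atoms M \<R> \<infinity>" for a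
  proof -
    obtain R where R: "R \<in> \<R>" and supp: "\<And>x. x \<notin> R \<Longrightarrow> a x = 0"
      and mean: "(\<Sum>x\<in>R. weight x *\<^sub>R a x) = 0"
      using a unfolding atoms_infinity_iff by blast
    have fin: "finite R" by (rule finite_family[OF R])
    obtain r where r: "r \<in> R" using nonempty_family[OF R] by blast
    let ?d = "\<lambda>S z. \<Sum>x\<in>S. (weight x *\<^sub>R a x) * dipole x r z"
    \<comment> \<open>Every partial sum is supported in \<open>R\<close> and has mean zero, hence lies in the Hardy space.\<close>
    have d_hardy: "?d S \<in> hardy M \<R> \<infinity>" if S: "S \<subseteq> R" for S
    proof -
      have "\<exists>c a'. a' \<in> atoms M \<R> \<infinity> \<and> ?d S = (\<lambda>x. c * a' x)"
      proof (rule mean_zero_eq_scaled_atom[OF R])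
        show "?d S z = 0" if "z \<notin> R" for z
          using that S r by (intro sum.neutral) (auto simp: dipole_def indicator_def)
        have "(\<Sum>z\<in>R. weight z *\<^sub>R ?d S z) =
            (\<Sum>x\<in>S. (weight x *\<^sub>R a x) * (\<Sum>z\<in>R. weight z *\<^sub>R (1 * dipole x r z)))"
          unfolding scaleR_sum_right sum_distrib_left
          by (subst sum.swap) (simp add: scaleR_conv_of_real mult_ac)
        also have "\<dots> = 0"
          using S r by (intro sum.neutral ballI) (subst sum_mult_dipole[OF fin], auto)
        finally show "(\<Sum>z\<in>R. weight z *\<^sub>R ?d S z) = 0" .
      qed
      then show ?thesis using scaled_atom_hardy(1) by fastforce
    qed
    have L_d: "L (?d S) = (\<Sum>x\<in>S. (weight x *\<^sub>R a x) * (f x - f r))" if S: "S \<subseteq> R" for S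
      using finite_subset[OF S fin] S
    proof (induction S rule: finite_induct)
      case empty
      then show ?case using scale[OF dipole, of 0] by simp
    next
      case (insert x S)
      then show ?case
        using add[OF hardy_scale(1)[OF dipole] d_hardy[of S], of "weight x *\<^sub>R a x" x r]
          scale[OF dipole, of "weight x *\<^sub>R a x" x r]
        by (simp add: diff)
    qed
    have a_eq: "a = ?d R"
    proof
      fix z
      have "?d R z = (\<Sum>x\<in>R. (weight x *\<^sub>R a x) * (indicator {x} z / complex_of_real (weight x)))
          - (\<Sum>x\<in>R. weight x *\<^sub>R a x) * (indicator {r} z / complex_of_real (weight r))"
        by (simp only: dipole_def right_diff_distrib sum_subtractf sum_distrib_right)
      also have "\<dots> = (\<Sum>x\<in>R. (weight x *\<^sub>R a x) * (indicator {x} z / complex_of_real (weight x)))"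
        by (simp add: mean)
      also have "\<dots> = (\<Sum>x\<in>R. if x = z then a x else 0)"
      proof (rule sum.cong[OF refl])
        fix x
        show "(weight x *\<^sub>R a x) * (indicator {x} z / complex_of_real (weight x)) =
            (if x = z then a x else 0)"
          using weight_pos[of x] by (auto simp: scaleR_conv_of_real)
      qed
      also have "\<dots> = a z" using supp fin by auto
      finally show "a z = ?d R z" ..
    qed
    have "L a = (\<Sum>x\<in>R. (weight x *\<^sub>R a x) * (f x - f r))"
      using L_d[OF subset_refl] a_eq by simp
    also have "\<dots> = (\<Sum>x\<in>R. weight x *\<^sub>R (f x * a x)) - (\<Sum>x\<in>R. weight x *\<^sub>R a x) * f r"
      unfolding right_diff_distrib sum_subtractf sum_distrib_right
      by (simp add: mult.commute)
    also have "\<dots> = (\<integral>x. f x * a x \<partial>M)"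
      using integral_finite_support[OF fin, of "\<lambda>x. f x * a x"] supp mean by simp
    finally show ?thesis .
  qed
  then show ?thesis by blast
qed

lemma bounded_functional_represented:
  assumes L: "bounded_functional M \<R> L"
  shows "\<exists>f\<in>BMO_functions M \<R>. \<forall>g\<in>hardy M \<R> \<infinity>. L g = pairing f g"
proof -
  obtain f where f: "\<And>a. a \<in> atoms M \<R> \<infinity> \<Longrightarrow> L a = (\<integral>x. f x * a x \<partial>M)"
    using bounded_functional_represented_on_atoms[OF L] by blast
  obtain K where K: "\<And>g. g \<in> hardy M \<R> \<infinity> \<Longrightarrow> cmod (L g) \<le> K * hardy_norm M \<R> \<infinity> g"
    using L unfolding bounded_functional_def by blast
  have "mean_oscillation M f R \<le> 2 * \<bar>K\<bar>" if R: "R \<in> \<R>" for R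
  proof -
    obtain b where b: "(\<lambda>x. b x / 2) \<in> atoms M \<R> \<infinity>"
      "complex_of_real (mean_oscillation M f R) = (\<integral>x. f x * b x \<partial>M)"
      using mean_oscillation_tested_by_atom[OF R] by blast
    note h = scaled_atom_hardy[OF b(1), of 1, unfolded mult_1]
    have "complex_of_real (mean_oscillation M f R) = 2 * L (\<lambda>x. b x / 2)"
      using f[OF b(1)] b(2) by (simp add: mult.commute)
    then have "\<bar>mean_oscillation M f R\<bar> = 2 * cmod (L (\<lambda>x. b x / 2))"
      by (metis norm_mult norm_numeral norm_of_real)
    also have "\<dots> \<le> 2 * (\<bar>K\<bar> * hardy_norm M \<R> \<infinity> (\<lambda>x. b x / 2))"
      using K[OF h(1)] hardy_norm_nonneg[OF h(1)]
      by (smt (verit) mult_right_mono)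
    also have "\<dots> \<le> 2 * \<bar>K\<bar>" using h(2) by (simp add: mult_left_le)
    finally show ?thesis by simp
  qed
  then have "bdd_above (mean_oscillation M f ` \<R>)" by (rule bdd_aboveI2)
  then have fB: "f \<in> BMO_functions M \<R>" by (simp add: BMO_functions_def)
  have "L g = pairing f g" if g: "g \<in> hardy M \<R> \<infinity>" for g
  proof -
    obtain c a where dec: "atomic_decomposition M \<R> \<infinity> g c a" using g by (auto simp: hardy_def)
    then have "\<And>j. L (a j) = (\<integral>x. f x * a j x \<partial>M)"
      using f by (auto simp: atomic_decomposition_def)
    then show ?thesis
      using bounded_functional_sums[OF L dec] pairing_eq_suminf[OF fB dec] by (simp add: sums_iff)
  qed
  then show ?thesis using fB by blast
qed

section \<open>Duality for classes modulo constants\<close>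

lemma mean_oscillation_add_const:
  assumes R: "R \<in> \<R>"
  shows "mean_oscillation M (\<lambda>x. f x + c) R = mean_oscillation M f R"
proof -
  have fin: "finite R" by (rule finite_family[OF R])
  have "(\<Sum>x\<in>R. weight x *\<^sub>R c) = measure M R *\<^sub>R c"
    by (simp add: measure_eq_sum_weight[OF fin] scaleR_sum_left)
  then have "average M (\<lambda>x. f x + c) R = average M f R + c"
    using measure_family_pos[OF R]
    by (simp add: average_def integral_restrict_finite[OF fin] scaleR_add_right sum.distrib
        add_divide_distrib scaleR_conv_of_real[of "measure M R"])
  then show ?thesis by (simp add: mean_oscillation_eq_sum[OF R])
qed

lemma BMO_functions_add_const:
  assumes "f \<in> BMO_functions M \<R>" "\<And>x. f' x = f x + c"
  shows "f' \<in> BMO_functions M \<R>" "BMO_seminorm M \<R> f' = BMO_seminorm M \<R> f"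
proof -
  have "f' = (\<lambda>x. f x + c)" using assms(2) by blast
  then have "mean_oscillation M f' ` \<R> = mean_oscillation M f ` \<R>"
    by (auto simp: mean_oscillation_add_const)
  then show "f' \<in> BMO_functions M \<R>" "BMO_seminorm M \<R> f' = BMO_seminorm M \<R> f"
    using assms(1) by (simp_all add: BMO_functions_def BMO_seminorm_def)
qed

lemma BMO_class_eq:
  assumes "F \<in> BMO M \<R>" "f \<in> F"
  shows "f \<in> BMO_functions M \<R>" "F = {f'. \<exists>c. \<forall>x. f' x = f x + c}"
proof -
  from assms(1) obtain f0 where f0: "f0 \<in> BMO_functions M \<R>"
    and F: "F = {f' \<in> BMO_functions M \<R>. \<exists>c. \<forall>x. f' x = f0 x + c}"
    unfolding BMO_def quotient_def by auto
  then have F': "F = {f'. \<exists>c. \<forall>x. f' x = f0 x + c}"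
    using BMO_functions_add_const(1)[OF f0] by blast
  show "f \<in> BMO_functions M \<R>" using assms(2) F by blast
  obtain c where c: "\<And>x. f x = f0 x + c" using assms(2) F' by blast
  have "(\<exists>d. \<forall>x. f' x = f0 x + d) \<longleftrightarrow> (\<exists>d. \<forall>x. f' x = f x + d)" for f'
  proof
    assume "\<exists>d. \<forall>x. f' x = f0 x + d"
    then obtain d where "\<And>x. f' x = f0 x + d" by blast
    then show "\<exists>d. \<forall>x. f' x = f x + d" by (intro exI[of _ "d - c"]) (simp add: c)
  next
    assume "\<exists>d. \<forall>x. f' x = f x + d"
    then obtain d where "\<And>x. f' x = f x + d" by blast
    then show "\<exists>d. \<forall>x. f' x = f0 x + d" by (intro exI[of _ "c + d"]) (simp add: c)
  qed
  then show "F = {f'. \<exists>c. \<forall>x. f' x = f x + c}" by (simp add: F')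
qed

lemma BMO_class_of:
  assumes "f \<in> BMO_functions M \<R>"
  shows "{f'. \<exists>c. \<forall>x. f' x = f x + c} \<in> BMO M \<R>"
proof -
  have "{f'. \<exists>c. \<forall>x. f' x = f x + c} =
      {(f, f'). f \<in> BMO_functions M \<R> \<and> f' \<in> BMO_functions M \<R> \<and> (\<exists>c. \<forall>x. f' x = f x + c)} `` {f}"
    using assms BMO_functions_add_const(1)[OF assms] by auto
  then show ?thesis unfolding BMO_def using quotientI[OF assms] by (simp only:)
qed

lemma BMO_nonempty:
  assumes "F \<in> BMO M \<R>"
  shows "\<exists>f. f \<in> F"
proof -
  from assms obtain f where "f \<in> BMO_functions M \<R>"
    and "F = {f' \<in> BMO_functions M \<R>. \<exists>c. \<forall>x. f' x = f x + c}"
    unfolding BMO_def quotient_def by auto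
  then have "f \<in> F" by (auto intro: exI[of _ 0])
  then show ?thesis by blast
qed

lemma BMO_norm_eq:
  assumes "F \<in> BMO M \<R>" "f \<in> F"
  shows "BMO_norm M \<R> F = BMO_seminorm M \<R> f"
proof -
  have "BMO_seminorm M \<R> ` F = (\<lambda>_. BMO_seminorm M \<R> f) ` F"
  proof (rule image_cong[OF refl])
    fix f' assume "f' \<in> F"
    then obtain c where "\<And>x. f' x = f x + c" using BMO_class_eq(2)[OF assms] by blast
    then show "BMO_seminorm M \<R> f' = BMO_seminorm M \<R> f"
      by (rule BMO_functions_add_const(2)[OF BMO_class_eq(1)[OF assms]])
  qed
  also have "\<dots> = {BMO_seminorm M \<R> f}" using assms(2) by blast
  finally have "BMO_seminorm M \<R> ` F = {BMO_seminorm M \<R> f}" .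
  then show ?thesis by (simp add: BMO_norm_def)
qed

text \<open>Any representative gives the same functional, since atoms have mean zero
  (\<open>class_functional_eq_pairing\<close>).\<close>

definition class_functional :: "('v \<Rightarrow> complex) set \<Rightarrow> ('v \<Rightarrow> complex) \<Rightarrow> complex" where
  "class_functional F = pairing (SOME f. f \<in> F)"

lemma class_functional_representative:
  assumes F: "F \<in> BMO M \<R>"
  obtains f where "f \<in> F" "f \<in> BMO_functions M \<R>" "class_functional F = pairing f"
    "BMO_norm M \<R> F = BMO_seminorm M \<R> f"
  using someI_ex[OF BMO_nonempty[OF F]] BMO_class_eq(1)[OF F] BMO_norm_eq[OF F]
  by (auto simp: class_functional_def)

lemma class_functional_eq_pairing:
  assumes F: "F \<in> BMO M \<R>" and f: "f \<in> F" and g: "g \<in> hardy M \<R> \<infinity>"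
  shows "class_functional F g = pairing f g"
proof -
  obtain f0 where f0: "f0 \<in> F" "f0 \<in> BMO_functions M \<R>" "class_functional F = pairing f0"
    using class_functional_representative[OF F] by blast
  then obtain d where d: "\<And>x. f x = f0 x + d" using BMO_class_eq(2)[OF F f0(1)] f by blast
  obtain c a where dec: "atomic_decomposition M \<R> \<infinity> g c a" using g by (auto simp: hardy_def)
  have "(\<integral>x. f x * a j x \<partial>M) = (\<integral>x. f0 x * a j x \<partial>M)" for j
  proof -
    have a: "a j \<in> atoms M \<R> \<infinity>" using dec by (simp add: atomic_decomposition_def)
    have "(\<integral>x. f x * a j x \<partial>M) = (\<integral>x. f0 x * a j x \<partial>M) + (\<integral>x. d * a j x \<partial>M)"
      unfolding d distrib_right
      by (intro Bochner_Integration.integral_add atom_mult_integrable[OF a])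
    then show ?thesis by (simp add: atom_integral[OF a])
  qed
  then show ?thesis
    unfolding f0(3) pairing_eq_suminf[OF f0(2) dec]
      pairing_eq_suminf[OF BMO_class_eq(1)[OF F f] dec] by simp
qed

lemma hardy_fin_subset_hardy: "hardy_fin M \<R> \<infinity> \<subseteq> hardy M \<R> \<infinity>"
proof
  fix g assume "g \<in> hardy_fin M \<R> \<infinity>"
  then obtain n :: nat and c a where g: "g = (\<lambda>x. \<Sum>j<n. c j * a j x)"
    and a: "\<And>j. j < n \<Longrightarrow> a j \<in> atoms M \<R> \<infinity>"
    unfolding hardy_fin_def by blast
  define a' where "a' j = (if j < n then a j else (\<lambda>_. 0))" for j
  have "(\<lambda>x. \<Sum>j<n. c j * a' j x) \<in> hardy M \<R> \<infinity>"
    by (rule decomposition_finite_sum(1)) (simp add: a'_def a zero_atom)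
  also have "(\<lambda>x. \<Sum>j<n. c j * a' j x) = g" by (simp add: g a'_def)
  finally show "g \<in> hardy M \<R> \<infinity>" .
qed

lemma class_functional_hardy_fin:
  assumes F: "F \<in> BMO M \<R>" and f: "f \<in> F" and g: "g \<in> hardy_fin M \<R> \<infinity>"
  shows "class_functional F g = (\<integral>x. f x * g x \<partial>M)"
  using class_functional_eq_pairing[OF F f] g hardy_fin_subset_hardy
    pairing_finite_support[OF hardy_fin_finite_support[OF g]] by auto

text \<open>Dipoles recover the differences \<open>f x - f y\<close> and hence \<open>f\<close> up to a constant.\<close>

lemma class_functional_injective:
  assumes F: "F \<in> BMO M \<R>" and G: "G \<in> BMO M \<R>"
    and eq: "\<And>g. g \<in> hardy M \<R> \<infinity> \<Longrightarrow> class_functional F g = class_functional G g"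
  shows "F = G"
proof -
  obtain f where f: "f \<in> F" "class_functional F = pairing f"
    using class_functional_representative[OF F] by blast
  obtain f' where f': "f' \<in> G" "class_functional G = pairing f'"
    using class_functional_representative[OF G] by blast
  have dip: "pairing h (dipole x y) = h x - h y" for h x y
  proof -
    obtain R where R: "R \<in> \<R>" "x \<in> R" "y \<in> R" using two_points by blast
    have fin: "finite R" by (rule finite_family[OF R(1)])
    have supp: "dipole x y z = 0" if "z \<notin> R" for z
      using that R by (auto simp: dipole_def indicator_def)
    then have "finite {z. dipole x y z \<noteq> 0}" by (intro finite_subset[OF _ fin]) auto
    then have "pairing h (dipole x y) = (\<integral>z. h z * dipole x y z \<partial>M)"
      by (rule pairing_finite_support)
    also have "\<dots> = h x - h y"
      using integral_finite_support[OF fin, of "\<lambda>z. h z * dipole x y z"] supp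
        sum_mult_dipole[OF fin R(2,3)] by simp
    finally show ?thesis .
  qed
  have "f x - f y = f' x - f' y" for x y
  proof -
    have "dipole x y \<in> hardy M \<R> \<infinity>"
      using dipole_scaled_atom[of x y] scaled_atom_hardy(1) by fastforce
    from eq[OF this] show ?thesis by (simp add: f(2) f'(2) dip)
  qed
  then have "f' x = f x + (f' y - f y)" for x y by (simp add: algebra_simps)
  then have "f' \<in> F" unfolding BMO_class_eq(2)[OF F f(1)] by blast
  then show ?thesis using BMO_class_eq(2)[OF F] BMO_class_eq(2)[OF G f'(1)] by simp
qed

lemma BMO_norm_le_dual_norm:
  assumes L: "bounded_functional M \<R> L" and F: "F \<in> BMO M \<R>"
    and eq: "\<And>g. g \<in> hardy M \<R> \<infinity> \<Longrightarrow> L g = class_functional F g"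
    and C: "\<And>g. g \<in> hardy M \<R> 2 \<Longrightarrow> hardy_norm M \<R> \<infinity> g \<le> C * hardy_norm M \<R> 2 g"
  shows "BMO_norm M \<R> F \<le> C * dual_norm M \<R> L"
proof -
  obtain f where f: "f \<in> F" "f \<in> BMO_functions M \<R>" "class_functional F = pairing f"
    "BMO_norm M \<R> F = BMO_seminorm M \<R> f"
    by (rule class_functional_representative[OF F])
  let ?D = "dual_norm M \<R> L"
  have dual_cong: "?D = dual_norm M \<R> (pairing f)"
    unfolding dual_norm_def using eq by (intro SUP_cong) (auto simp: f(3))
  have D0: "0 \<le> ?D" by (rule dual_norm_nonneg[OF L])
  have "BMO_seminorm M \<R> f \<le> max C 0 * ?D"
    unfolding BMO_seminorm_def
  proof (rule cSUP_least)
    show "\<R> \<noteq> {}" using two_points by blast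
    fix R assume R: "R \<in> \<R>"
    obtain b where b: "(\<lambda>x. b x / 2) \<in> atoms M \<R> \<infinity>" "b \<in> atoms M \<R> 2"
      "complex_of_real (mean_oscillation M f R) = (\<integral>x. f x * b x \<partial>M)"
      using mean_oscillation_tested_by_atom[OF R] by blast
    have b_hardy: "b \<in> hardy M \<R> \<infinity>"
      using scaled_atom_hardy(1)[OF b(1), of 2] by simp
    note b2 = scaled_atom_hardy[OF b(2), of 1, unfolded mult_1]
    have "L b = complex_of_real (mean_oscillation M f R)"
      using eq[OF b_hardy] pairing_finite_support[OF atom_finite_support[OF b(2)], of f] b(3)
      by (simp add: f(3))
    then have "mean_oscillation M f R \<le> cmod (L b)" by simp
    also have "\<dots> \<le> ?D * hardy_norm M \<R> \<infinity> b"
      by (rule bounded_functional_le_dual_norm[OF L b_hardy])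
    also have "\<dots> \<le> ?D * (max C 0 * 1)"
    proof (intro mult_left_mono D0)
      have "hardy_norm M \<R> \<infinity> b \<le> C * hardy_norm M \<R> 2 b" by (rule C[OF b2(1)])
      also have "\<dots> \<le> max C 0 * hardy_norm M \<R> 2 b"
        by (intro mult_right_mono hardy_norm_nonneg[OF b2(1)]) simp
      also have "\<dots> \<le> max C 0 * 1" using b2(2) by (intro mult_left_mono) auto
      finally show "hardy_norm M \<R> \<infinity> b \<le> max C 0 * 1" .
    qed
    finally show "mean_oscillation M f R \<le> max C 0 * ?D" by (simp add: mult.commute)
  qed
  then have le: "BMO_norm M \<R> F \<le> max C 0 * ?D" by (simp add: f(4))
  have dual_le: "?D \<le> BMO_norm M \<R> F"
    unfolding dual_cong f(4) by (rule dual_norm_pairing_le[OF f(2)])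
  show ?thesis
  proof (cases "0 \<le> C")
    case True
    then show ?thesis using le by (simp add: max_def)
  next
    case False
    \<comment> \<open>A negative \<open>C\<close> would force both norms to vanish.\<close>
    then have "BMO_norm M \<R> F \<le> 0" using le by (simp add: max_def)
    moreover from this have "?D = 0" using D0 dual_le by linarith
    ultimately show ?thesis by simp
  qed
qed

theorem hardy_BMO_duality:
  "\<exists>\<Lambda> :: ('v \<Rightarrow> complex) set \<Rightarrow> ('v \<Rightarrow> complex) \<Rightarrow> complex.
    (\<exists>A>0. \<forall>F\<in>BMO M \<R>.
        bounded_functional M \<R> (\<Lambda> F) \<and>
        (\<forall>f\<in>F. \<forall>g\<in>hardy_fin M \<R> \<infinity>. \<Lambda> F g = (\<integral>x. f x * g x \<partial>M)) \<and>
        dual_norm M \<R> (\<Lambda> F) \<le> A * BMO_norm M \<R> F) \<and>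
    (\<forall>L. bounded_functional M \<R> L \<longrightarrow>
        (\<exists>!F. F \<in> BMO M \<R> \<and> (\<forall>g\<in>hardy M \<R> \<infinity>. L g = \<Lambda> F g)) \<and>
        (\<forall>F\<in>BMO M \<R>. (\<forall>g\<in>hardy M \<R> \<infinity>. L g = \<Lambda> F g) \<longrightarrow>
           (\<forall>C. (\<forall>g\<in>hardy M \<R> 2. hardy_norm M \<R> \<infinity> g \<le> C * hardy_norm M \<R> 2 g) \<longrightarrow>
              BMO_norm M \<R> F \<le> C * dual_norm M \<R> L)))"
proof (intro exI[of _ class_functional] conjI exI[of _ "1::real"] ballI allI impI)
  fix F assume F: "F \<in> BMO M \<R>"
  obtain f where f: "f \<in> BMO_functions M \<R>" "class_functional F = pairing f"
    "BMO_norm M \<R> F = BMO_seminorm M \<R> f"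
    by (rule class_functional_representative[OF F])
  show "bounded_functional M \<R> (class_functional F)"
    using bounded_functional_pairing[OF f(1)] f(2) by simp
  show "dual_norm M \<R> (class_functional F) \<le> 1 * BMO_norm M \<R> F"
    using dual_norm_pairing_le[OF f(1)] f(2,3) by simp
  fix h g assume "h \<in> F" "g \<in> hardy_fin M \<R> \<infinity>"
  then show "class_functional F g = (\<integral>x. h x * g x \<partial>M)"
    by (rule class_functional_hardy_fin[OF F])
next
  fix L assume L: "bounded_functional M \<R> L"
  obtain f where f: "f \<in> BMO_functions M \<R>" and Lf: "\<forall>g\<in>hardy M \<R> \<infinity>. L g = pairing f g"
    using bounded_functional_represented[OF L] by blast
  let ?F = "{f'. \<exists>c. \<forall>x. f' x = f x + c}"
  have F: "?F \<in> BMO M \<R>" by (rule BMO_class_of[OF f])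
  have f_F: "f \<in> ?F" by (auto intro: exI[of _ 0])
  have eq: "L g = class_functional ?F g" if "g \<in> hardy M \<R> \<infinity>" for g
    using class_functional_eq_pairing[OF F f_F that] Lf that by simp
  show "\<exists>!F. F \<in> BMO M \<R> \<and> (\<forall>g\<in>hardy M \<R> \<infinity>. L g = class_functional F g)"
  proof (rule ex1I[of _ ?F])
    show "?F \<in> BMO M \<R> \<and> (\<forall>g\<in>hardy M \<R> \<infinity>. L g = class_functional ?F g)"
      using F eq by blast
    fix G assume G: "G \<in> BMO M \<R> \<and> (\<forall>g\<in>hardy M \<R> \<infinity>. L g = class_functional G g)"
    show "G = ?F"
    proof (rule class_functional_injective)
      show "class_functional G g = class_functional ?F g" if "g \<in> hardy M \<R> \<infinity>" for g
        using G eq[OF that] that by simp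
    qed (use F G in auto)
  qed
next
  fix L F C
  assume "bounded_functional M \<R> L" "F \<in> BMO M \<R>"
    "\<forall>g\<in>hardy M \<R> \<infinity>. L g = class_functional F g"
    "\<forall>g\<in>hardy M \<R> 2. hardy_norm M \<R> \<infinity> g \<le> C * hardy_norm M \<R> 2 g"
  then show "BMO_norm M \<R> F \<le> C * dual_norm M \<R> L"
    by (intro BMO_norm_le_dual_norm) auto
qed simp

end

section \<open>Duality on the tree\<close>

theorem theorem13:
  fixes m :: nat and E :: "'v \<Rightarrow> 'v \<Rightarrow> bool" and g0 :: "'v set" and N :: "'v \<Rightarrow> int"
    and \<mu> :: "'v measure" and \<R> :: "'v set set"
  assumes m: "2 \<le> m"
    and tree: "homogeneous_tree m E"
    and geodesic: "infinite_geodesic E g0"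
    and labelling: "\<And>x y. x \<in> g0 \<Longrightarrow> y \<in> g0 \<Longrightarrow> \<bar>N x - N y\<bar> = int (graph_dist E x y)"
    and mu: "\<mu> = tree_measure m E g0 N"
    and CZ: "\<R> = CZ_sets E g0 N"
  shows "\<exists>\<Lambda> :: ('v \<Rightarrow> complex) set \<Rightarrow> ('v \<Rightarrow> complex) \<Rightarrow> complex.
    (\<exists>A>0. \<forall>F\<in>BMO \<mu> \<R>.
        bounded_functional \<mu> \<R> (\<Lambda> F) \<and>
        (\<forall>f\<in>F. \<forall>g\<in>hardy_fin \<mu> \<R> \<infinity>. \<Lambda> F g = (\<integral>x. f x * g x \<partial>\<mu>)) \<and>
        dual_norm \<mu> \<R> (\<Lambda> F) \<le> A * BMO_norm \<mu> \<R> F) \<and>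
    (\<forall>L. bounded_functional \<mu> \<R> L \<longrightarrow>
        (\<exists>!F. F \<in> BMO \<mu> \<R> \<and> (\<forall>g\<in>hardy \<mu> \<R> \<infinity>. L g = \<Lambda> F g)) \<and>
        (\<forall>F\<in>BMO \<mu> \<R>. (\<forall>g\<in>hardy \<mu> \<R> \<infinity>. L g = \<Lambda> F g) \<longrightarrow>
           (\<forall>C\<^sub>2. (\<forall>g\<in>hardy \<mu> \<R> 2. hardy_norm \<mu> \<R> \<infinity> g \<le> C\<^sub>2 * hardy_norm \<mu> \<R> 2 g) \<longrightarrow>
              BMO_norm \<mu> \<R> F \<le> C\<^sub>2 * dual_norm \<mu> \<R> L)))"
proof -
  have "discrete_atomic_space \<mu> \<R>"
  proof
    show "sets \<mu> = UNIV" by (simp add: mu tree_measure_def sets_point_measure)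
    have "emeasure \<mu> {x} = ennreal (real m powi level E g0 N x)" for x
      by (simp add: mu tree_measure_def emeasure_point_measure_finite2)
    then show "0 < emeasure \<mu> {x}" "emeasure \<mu> {x} < top" for x
      using m by (simp_all add: zero_less_power_int)
    show "finite R" if "R \<in> \<R>" for R
      using that finite_CZ_set[OF tree] by (simp add: CZ)
    show "R \<noteq> {}" if "R \<in> \<R>" for R
      using that by (simp add: CZ CZ_sets_def)
    show "\<exists>R\<in>\<R>. x \<in> R \<and> y \<in> R" for x y
      unfolding CZ by (rule CZ_set_containing_two_points[OF tree geodesic labelling])
  qed
  then show ?thesis by (rule discrete_atomic_space.hardy_BMO_duality)
qed

end
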